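(* Let $a,b,c$ be positive numbers with $a<b<c$, $\lfloor c/b\rfloor\ge2$, $b-a<c_0<a$, $0<c_1<2a-b$, and $a/b\notin\mathbb Q$, where $c_0=c-\lfloor c/b\rfloor b$ and $c_1=c-c_0-\lfloor(c-c_0)/a\rfloor a$. Then $\mathcal S_{a,b,c}\ne\emptyset$ if and only if there exist nonnegative integers $d_1,d_2$ such that (1) $c-(d_1+1)(\lfloor c/b\rfloor+1)(b-a)-(d_2+1)\lfloor c/b\rfloor(b-a)\in a\mathbb Z$; (2) $\lfloor c/b\rfloor b+(d_1+1)(b-a)<c<\lfloor c/b\rfloor b+b-(d_2+1)(b-a)$; (3) $\#E_{a,b,c}=d_1$, where, with $m=\big((d_1+d_2+1)c_1-c_0+(d_1+1)(b-a)\big)/a$, $E_{a,b,c}=\{n\in\mathbb Z\cap[1,d_1+d_2+1]: n(c_1-m(b-a))\in[0,c_0-(d_1+1)(b-a))+(a-(d_1+d_2+1)(b-a))\mathbb Z\}$.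
   Context: For $a,b,c>0$ and $t\in\mathbb R$, $\mathbf M_{a,b,c}(t)=(\chi_{[0,c)}(t-\mu+\lambda))_{\mu\in a\mathbb Z,\lambda\in b\mathbb Z}$ is the infinite matrix with rows indexed by $a\mathbb Z$ and columns by $b\mathbb Z$, acting by $(\mathbf M_{a,b,c}(t)\mathbf x)(\mu)=\sum_{\lambda\in b\mathbb Z}\chi_{[0,c)}(t-\mu+\lambda)\mathbf x(\lambda)$. $\mathcal B_b^0$ is the set of vectors $(\mathbf x(\lambda))_{\lambda\in b\mathbb Z}$ with entries in $\{0,1\}$ and $\mathbf x(0)=1$. $\mathbf 1$ denotes the vector indexed by $a\mathbb Z$ with all entries $1$. $\mathcal S_{a,b,c}=\{t:\mathbf M_{a,b,c}(t)\mathbf x=\mathbf 1\text{ for some }\mathbf x\in\mathcal B_b^0\}$. $\#$ denotes cardinality and $A+r\mathbb Z=\{x+rk:x\in A,k\in\mathbb Z\}$. *)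

theory Defs
  imports Complex_Main
begin

text \<open>Vectors indexed by b*Z are represented as functions on int (index k stands for lambda = k*b);
rows indexed by a*Z are indexed by j (mu = j*a).\<close>

definition Mentry :: "real \<Rightarrow> real \<Rightarrow> real \<Rightarrow> real \<Rightarrow> int \<Rightarrow> int \<Rightarrow> real" where
  "Mentry a b c t j k = (if t - a * of_int j + b * of_int k \<in> {0..<c} then 1 else 0)"

text \<open>(M x)(mu) : only finitely many entries of a row are nonzero, so the row sum is a finite sum
over the support of the row.\<close>
definition Mmult :: "real \<Rightarrow> real \<Rightarrow> real \<Rightarrow> real \<Rightarrow> (int \<Rightarrow> real) \<Rightarrow> int \<Rightarrow> real" where
  "Mmult a b c t x j = (\<Sum>k\<in>{k::int. Mentry a b c t j k \<noteq> 0}. Mentry a b c t j k * x k)"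

definition B0 :: "(int \<Rightarrow> real) set" where
  "B0 = {x. (\<forall>k. x k \<in> {0, 1}) \<and> x 0 = 1}"

definition S_set :: "real \<Rightarrow> real \<Rightarrow> real \<Rightarrow> real set" where
  "S_set a b c = {t. \<exists>x\<in>B0. \<forall>j::int. Mmult a b c t x j = 1}"

definition lattice :: "real \<Rightarrow> real set" where
  "lattice r = {r * of_int k | k::int. True}"

definition plus_lattice :: "real set \<Rightarrow> real \<Rightarrow> real set" where
  "plus_lattice A r = {x + r * of_int k | x k. x \<in> A \<and> (k::int) = k}"

end

theory Submission
  imports Defs
begin

text \<open>
  Let \<open>T = {t + bk. x k = 1}\<close>; the equations say that every window \<open>[aj, aj + c)\<close> contains exactly
  one point of \<open>T\<close>. With \<open>\<delta> = b - a\<close> and residues modulo \<open>a\<close>, the point of \<open>T\<close> following \<open>\<tau>\<close> is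
  \<open>\<tau> + (N + 1) b\<close> if \<open>\<tau> < c0 - \<delta>\<close> and \<open>\<tau> + N b\<close> if \<open>\<tau> \<ge> c0\<close>, and no such point exists if
  \<open>c0 - \<delta> \<le> \<tau> < c0\<close>. Thus \<open>P = T + a\<int>\<close> is mapped bijectively and monotonically onto itself by
  \<open>F s = s + c1 + \<delta>\<close> (\<open>s < c0\<close>), \<open>F s = s + c1\<close> (\<open>s \<ge> c0\<close>). A gap of \<open>P\<close> is translated by \<open>F\<close>,
  except that a gap at \<open>0\<close> grows by \<open>\<delta>\<close> and a gap at \<open>c0\<close> shrinks by \<open>\<delta>\<close>. As \<open>a/b\<close> is irrational no
  gap is periodic, and infinitely many disjoint gaps of equal length do not fit into a circle. Hence
  the gap of length \<open>\<delta>\<close> created at \<open>0\<close> is carried after finitely many steps exactly onto the gap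
  \<open>[c0 - \<delta>, c0)\<close>, with \<open>d1\<close> intermediate gaps below \<open>c0\<close> and \<open>d2\<close> above. Collapsing these
  \<open>D = d1 + d2 + 1\<close> gaps turns \<open>F\<close> into the rotation by \<open>c1 - m\<delta>\<close> of a circle of length
  \<open>a - D\<delta>\<close>, which gives the three conditions. Conversely, opening gaps of length \<open>\<delta>\<close> at the first
  \<open>D\<close> points of the rotation orbit of \<open>0\<close> recovers \<open>T\<close>.
\<close>

section \<open>Residues and packing\<close>

definition residue :: "real \<Rightarrow> real \<Rightarrow> real" where
  "residue a s = s - a * of_int \<lfloor>s / a\<rfloor>"

lemma residue_decomp: "s = residue a s + a * of_int \<lfloor>s / a\<rfloor>"
  by (simp add: residue_def)

lemma residue_bounds:
  assumes "0 < a"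
  shows "0 \<le> residue a s" "residue a s < a"
proof -
  have "of_int \<lfloor>s / a\<rfloor> \<le> s / a" "s / a < of_int \<lfloor>s / a\<rfloor> + 1" by linarith+
  then have "a * of_int \<lfloor>s / a\<rfloor> \<le> a * (s / a)" "a * (s / a) < a * (of_int \<lfloor>s / a\<rfloor> + 1)"
    using assms mult_left_mono mult_strict_left_mono by (blast intro: less_imp_le)+
  then show "0 \<le> residue a s" "residue a s < a"
    using assms by (simp_all add: residue_def algebra_simps)
qed

lemma residue_unique:
  assumes "0 < a" "s = x + a * of_int j" "0 \<le> x" "x < a"
  shows "residue a s = x" "\<lfloor>s / a\<rfloor> = j"
proof -
  have "s / a = x / a + of_int j" using assms by (simp add: field_simps)
  moreover have "0 \<le> x / a" "x / a < 1" using assms by simp_all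
  ultimately show "\<lfloor>s / a\<rfloor> = j" by linarith
  then show "residue a s = x" using assms(2) by (simp add: residue_def)
qed

text \<open>The last term is the borrow in a subtraction of residues. It later converts sums of
  floors into counts of residues.\<close>

lemma floor_diff_divide:
  assumes "0 < a"
  shows "\<lfloor>(x - y) / a\<rfloor> = \<lfloor>x / a\<rfloor> - \<lfloor>y / a\<rfloor> - (if residue a x < residue a y then 1 else 0)"
proof (rule residue_unique(2)[OF assms])
  let ?e = "if residue a x < residue a y then 1 else 0 :: real"
  show "x - y = (residue a x - residue a y + a * ?e) + a * of_int (\<lfloor>x / a\<rfloor> - \<lfloor>y / a\<rfloor> - (if residue a x < residue a y then 1 else 0))"
    by (simp add: residue_def algebra_simps)
  show "0 \<le> residue a x - residue a y + a * ?e" "residue a x - residue a y + a * ?e < a"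
    using residue_bounds[OF assms, of x] residue_bounds[OF assms, of y] by auto
qed

lemma mem_plus_lattice_iff:
  assumes "0 < L" "l \<le> L"
  shows "x \<in> plus_lattice {0..<l} L \<longleftrightarrow> residue L x < l"
proof
  assume "x \<in> plus_lattice {0..<l} L"
  then obtain y k where "x = y + L * of_int k" "0 \<le> y" "y < l"
    unfolding plus_lattice_def by auto
  then show "residue L x < l" using residue_unique(1)[OF assms(1), of x y k] assms(2) by simp
next
  assume "residue L x < l"
  then have "residue L x \<in> {0..<l}" using residue_bounds[OF assms(1)] by simp
  then show "x \<in> plus_lattice {0..<l} L"
    unfolding plus_lattice_def using residue_decomp[of x L] by blast
qed

text \<open>Cut the line from \<open>x\<close> on into cells of length \<open>\<delta>\<close>.
  Separated points occupy different cells, and cell 0 is empty, so the cell numbers start at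
  1.\<close>

lemma packing_bound:
  fixes Z :: "real set"
  assumes "finite Z" "0 < \<delta>" "x \<le> y" "\<And>z. z \<in> Z \<Longrightarrow> x + \<delta> \<le> z \<and> z \<le> y"
    and "\<And>z z'. z \<in> Z \<Longrightarrow> z' \<in> Z \<Longrightarrow> z < z' \<Longrightarrow> z + \<delta> \<le> z'"
  shows "\<delta> * of_nat (card Z) \<le> y - x"
proof -
  define f where "f z = \<lfloor>(z - x) / \<delta>\<rfloor>" for z
  have less: "f z < f z'" if "z \<in> Z" "z' \<in> Z" "z < z'" for z z'
  proof -
    have "(z - x) + \<delta> \<le> z' - x" using assms(5)[OF that] by simp
    from divide_right_mono[OF this, of \<delta>] have "(z - x) / \<delta> + 1 \<le> (z' - x) / \<delta>"
      using assms(2) by (simp add: add_divide_distrib)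
    then show ?thesis unfolding f_def by linarith
  qed
  have "inj_on f Z" by (rule inj_onI) (metis less linorder_neqE order_less_irrefl)
  moreover have "f ` Z \<subseteq> {1..\<lfloor>(y - x) / \<delta>\<rfloor>}"
  proof
    fix i assume "i \<in> f ` Z"
    then obtain z where z: "z \<in> Z" "i = f z" by blast
    have "1 \<le> (z - x) / \<delta>" "(z - x) / \<delta> \<le> (y - x) / \<delta>"
      using assms(4)[OF z(1)] assms(2) by (simp_all add: divide_right_mono pos_le_divide_eq)
    then show "i \<in> {1..\<lfloor>(y - x) / \<delta>\<rfloor>}" unfolding z(2) f_def by (simp add: floor_mono)
  qed
  ultimately have "card Z \<le> card {1..\<lfloor>(y - x) / \<delta>\<rfloor>}" by (metis card_image card_mono finite_atLeastAtMost_int)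
  moreover have "0 \<le> \<lfloor>(y - x) / \<delta>\<rfloor>" using assms(2,3) by simp
  ultimately have "int (card Z) \<le> \<lfloor>(y - x) / \<delta>\<rfloor>"
    unfolding card_atLeastAtMost_int by linarith
  then have "real (card Z) \<le> (y - x) / \<delta>" by linarith
  then show ?thesis using assms(2) by (simp add: pos_le_divide_eq mult.commute)
qed

lemma card_Collect_split:
  assumes "finite A" "\<And>i. i \<in> A \<Longrightarrow> R i \<longleftrightarrow> P i \<or> Q i" "\<And>i. i \<in> A \<Longrightarrow> \<not> (P i \<and> Q i)"
  shows "card {i \<in> A. R i} = card {i \<in> A. P i} + card {i \<in> A. Q i}"
proof -
  have "{i \<in> A. R i} = {i \<in> A. P i} \<union> {i \<in> A. Q i}" using assms(2) by blast
  then show ?thesis using assms(1,3) by (simp add: card_Un_disjoint disjoint_iff)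
qed

section \<open>Gaps under the map \<open>F\<close>\<close>

text \<open>Here \<open>\<delta>\<close> stands for \<open>b - a\<close>. The form of
  \<open>c1\<close> comes from reducing \<open>N * b = N * a + N * \<delta>\<close> by multiples of
  \<open>a\<close>; \<open>irrational\<close> is the irrationality of \<open>a / b\<close> in terms
  of \<open>\<delta>\<close> and \<open>a\<close>.\<close>

locale gap_map =
  fixes a \<delta> c0 c1 :: real and N p :: int
  assumes a_pos: "0 < a" and \<delta>_pos: "0 < \<delta>" and \<delta>_less: "\<delta> < c0" and c0_less: "c0 < a"
    and c1_eq: "c1 = of_int N * \<delta> + of_int p * a" and N_pos: "1 \<le> N"
    and irrational: "\<And>i j :: int. of_int i * \<delta> = of_int j * a \<Longrightarrow> i = 0"
begin

abbreviation md :: "real \<Rightarrow> real" where "md \<equiv> residue a"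

definition lower :: "real \<Rightarrow> real" where "lower s = (if md s < c0 then 1 else 0)"

text \<open>Modulo \<open>a\<close>, a step of \<open>N * b\<close> adds \<open>c1\<close> and a
  step of \<open>(N + 1) * b\<close> adds \<open>c1 + \<delta>\<close>. The map lives on the line
  instead of the circle so that order can be used.\<close>

definition F :: "real \<Rightarrow> real" where "F s = s + c1 + \<delta> * lower s"

lemmas md_bounds = residue_bounds[OF a_pos]

lemmas md_unique = residue_unique[OF a_pos]

lemmas md_decomp = residue_decomp[of _ a]

lemma md_shift [simp]: "md (s + a * of_int j) = md s"
  by (rule md_unique(1)[of _ _ "\<lfloor>s / a\<rfloor> + j"]) (use md_decomp[of s] md_bounds[of s] in \<open>simp_all add: algebra_simps\<close>)

lemma md_near:
  assumes "0 \<le> md s + (x - s)" "md s + (x - s) < a"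
  shows "md x = md s + (x - s)"
  by (rule md_unique(1)[of _ _ "\<lfloor>s / a\<rfloor>"]) (use assms md_decomp[of s] in auto)

lemma lower_shift [simp]: "lower (s + a * of_int j) = lower s"
  by (simp add: lower_def)

lemma F_shift: "F (s + a * of_int j) = F s + a * of_int j"
  by (simp add: F_def)

lemma lower_cases: "lower s = 0 \<or> lower s = 1"
  by (simp add: lower_def)

text \<open>Order could be lost only across residue \<open>c0\<close>, where \<open>F\<close> drops
  by \<open>\<delta>\<close>. Points on its two sides are more than \<open>\<delta>\<close> apart,
  since the arc \<open>[c0 - \<delta>, c0)\<close> is excluded.\<close>

lemma F_strict_mono:
  assumes "md r \<notin> {c0 - \<delta>..<c0}" "md s \<notin> {c0 - \<delta>..<c0}" "r < s"
  shows "F r < F s"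
proof (cases "md r < c0 \<and> \<not> md s < c0")
  case True
  have "\<lfloor>r / a\<rfloor> \<le> \<lfloor>s / a\<rfloor>"
    by (intro floor_mono divide_right_mono less_imp_le[OF assms(3)] less_imp_le[OF a_pos])
  then have "a * of_int \<lfloor>r / a\<rfloor> \<le> a * of_int \<lfloor>s / a\<rfloor>" using a_pos by simp
  then have "md s - md r \<le> s - r" using md_decomp[of r] md_decomp[of s] by linarith
  moreover have "\<delta> < md s - md r" using True assms by auto
  ultimately show ?thesis using True by (simp add: F_def lower_def)
next
  case False
  then show ?thesis using assms(3) \<delta>_pos by (auto simp: F_def lower_def)
qed

lemma F_iterate_displacement: "\<exists>e :: nat. (F ^^ n) r = r + of_nat n * c1 + \<delta> * of_nat e"
proof (induction n)
  case 0
  show ?case by (rule exI[of _ 0]) simp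
next
  case (Suc n)
  then obtain e :: nat where e: "(F ^^ n) r = r + of_nat n * c1 + \<delta> * of_nat e" by blast
  obtain i :: nat where i: "lower ((F ^^ n) r) = of_nat i"
    using lower_cases[of "(F ^^ n) r"] by (metis of_nat_0 of_nat_1)
  have "(F ^^ Suc n) r = (F ^^ n) r + c1 + \<delta> * of_nat i" using i F_def[of "(F ^^ n) r"] by simp
  also have "\<dots> = r + of_nat (Suc n) * c1 + \<delta> * of_nat (e + i)" unfolding e by (simp add: algebra_simps)
  finally show ?case by blast
qed

text \<open>Substituting \<open>c1\<close> would make \<open>(n * N + e) * \<delta>\<close> an
  integer multiple of \<open>a\<close>, with a positive coefficient. As \<open>e\<close> is
  arbitrary, the itinerary of an orbit need not be known.\<close>

lemma c1_multiple_not_lattice: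
  assumes "0 < n"
  shows "of_nat n * c1 + \<delta> * of_nat e \<noteq> a * of_int j"
proof
  assume "of_nat n * c1 + \<delta> * of_nat e = a * of_int j"
  then have "of_int (int n * N + int e) * \<delta> = of_int (j - int n * p) * a"
    by (simp add: c1_eq algebra_simps)
  then have "int n * N + int e = 0" by (rule irrational)
  moreover have "0 < int n * N" using assms N_pos by simp
  ultimately show False by linarith
qed

lemma F_iterate_not_periodic:
  assumes "n \<noteq> k"
  shows "(F ^^ n) r \<noteq> (F ^^ k) r + a * of_int j"
proof -
  have *: "(F ^^ n) r \<noteq> (F ^^ k) r + a * of_int j" if "k < n" for n k j
  proof -
    have "(F ^^ n) r = (F ^^ (n - k)) ((F ^^ k) r)"
      using funpow_add[of "n - k" k F] that by simp
    moreover obtain e :: nat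
      where "(F ^^ (n - k)) ((F ^^ k) r) = (F ^^ k) r + of_nat (n - k) * c1 + \<delta> * of_nat e"
      using F_iterate_displacement by blast
    moreover have "of_nat (n - k) * c1 + \<delta> * of_nat e \<noteq> a * of_int j"
      by (rule c1_multiple_not_lattice) (use that in simp)
    ultimately show ?thesis by linarith
  qed
  show ?thesis
  proof (cases "k < n")
    case False
    then have "n < k" using assms by simp
    from *[OF this, of "- j"] show ?thesis by auto
  qed (use * in blast)
qed

end

section \<open>Propagation of gaps in an invariant set\<close>

locale gap_orbit = gap_map +
  fixes P :: "real set"
  assumes P_nonempty: "P \<noteq> {}"
    and P_shift: "\<And>x j. x \<in> P \<Longrightarrow> x + a * of_int j \<in> P"
    and P_avoids: "\<And>x. x \<in> P \<Longrightarrow> md x \<notin> {c0 - \<delta>..<c0}"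
    and P_image: "\<And>x. x \<in> P \<Longrightarrow> F x \<in> P"
    and P_preimage: "\<And>x. x \<in> P \<Longrightarrow> \<exists>y\<in>P. F y = x"
begin

text \<open>Orbits are followed from such points because the infimum \<open>start\<close> below is
  not known to belong to \<open>P\<close>. Approximation from the right matches the right-continuity
  of \<open>lower\<close>.\<close>

definition right_limit :: "real \<Rightarrow> bool" where
  "right_limit r \<longleftrightarrow> (\<forall>\<eta>>0. \<exists>x\<in>P. r \<le> x \<and> x < r + \<eta>)"

text \<open>The number \<open>\<gamma>\<close> is only a lower bound for the length of the gap
  ending at \<open>r\<close>. For nonpositive \<open>\<gamma>\<close> the condition is vacuous, so
  subtracting \<open>\<delta>\<close> needs no case distinction.\<close>

definition gap :: "real \<Rightarrow> real \<Rightarrow> bool" where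
  "gap r \<gamma> \<longleftrightarrow> (\<forall>x\<in>P. x < r \<longrightarrow> x \<le> r - \<gamma>)"

lemma right_limit_between:
  assumes "right_limit r" "r < s"
  shows "\<exists>x\<in>P. r \<le> x \<and> x < s"
proof -
  have "0 < s - r" using assms by simp
  then obtain x where "x \<in> P" "r \<le> x" "x < r + (s - r)"
    using assms(1) unfolding right_limit_def by blast
  then show ?thesis by auto
qed

lemma right_limit_shift:
  assumes "right_limit r"
  shows "right_limit (r + a * of_int j)"
  unfolding right_limit_def
proof (intro allI impI)
  fix \<eta> :: real assume "0 < \<eta>"
  then obtain x where "x \<in> P" "r \<le> x" "x < r + \<eta>"
    using assms unfolding right_limit_def by blast
  then show "\<exists>x\<in>P. r + a * of_int j \<le> x \<and> x < r + a * of_int j + \<eta>"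
    by (intro bexI[of _ "x + a * of_int j"] P_shift) auto
qed

lemma gap_separates:
  assumes "right_limit r" "gap s \<gamma>" "r < s"
  shows "r \<le> s - \<gamma>"
proof -
  obtain x where "x \<in> P" "r \<le> x" "x < s" using right_limit_between[OF assms(1,3)] by blast
  then show ?thesis using assms(2) unfolding gap_def by force
qed

lemma right_limit_avoids:
  assumes "right_limit r"
  shows "md r \<notin> {c0 - \<delta>..<c0}"
proof
  assume H: "md r \<in> {c0 - \<delta>..<c0}"
  then have "r < r + (c0 - md r)" by simp
  then obtain x where x: "x \<in> P" "r \<le> x" "x < r + (c0 - md r)"
    using right_limit_between[OF assms] by blast
  have "md x = md r + (x - r)"
    by (rule md_near) (use x md_bounds[of r] c0_less in auto)
  then show False using P_avoids[OF x(1)] x H by auto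
qed

lemma lower_near:
  "\<exists>\<eta>>0. \<forall>x. r \<le> x \<longrightarrow> x < r + \<eta> \<longrightarrow> lower x = lower r"
proof (cases "md r < c0")
  case True
  have "lower x = lower r" if "r \<le> x" "x < r + (c0 - md r)" for x
  proof -
    have "md x = md r + (x - r)"
      by (rule md_near) (use that md_bounds[of r] c0_less in auto)
    then show ?thesis using True that by (simp add: lower_def)
  qed
  moreover have "0 < c0 - md r" using True by simp
  ultimately show ?thesis by blast
next
  case False
  have "lower x = lower r" if "r \<le> x" "x < r + (a - md r)" for x
  proof -
    have "md x = md r + (x - r)"
      by (rule md_near) (use that md_bounds[of r] c0_less in auto)
    then show ?thesis using False that by (simp add: lower_def)
  qed
  moreover have "0 < a - md r" using md_bounds[of r] by simp
  ultimately show ?thesis by blast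
qed

lemma right_limit_F:
  assumes "right_limit r"
  shows "right_limit (F r)"
  unfolding right_limit_def
proof (intro allI impI)
  fix \<eta> :: real assume "0 < \<eta>"
  obtain \<eta>' where \<eta>': "0 < \<eta>'" "\<And>x. r \<le> x \<Longrightarrow> x < r + \<eta>' \<Longrightarrow> lower x = lower r"
    using lower_near[of r] by blast
  obtain x where x: "x \<in> P" "r \<le> x" "x < r + min \<eta> \<eta>'"
    using right_limit_between[OF assms, of "r + min \<eta> \<eta>'"] \<eta>'(1) \<open>0 < \<eta>\<close> by auto
  then have "lower x = lower r" using \<eta>'(2)[of x] by linarith
  then have "F r \<le> F x \<and> F x < F r + \<eta>" using x by (auto simp: F_def)
  then show "\<exists>x\<in>P. F r \<le> x \<and> x < F r + \<eta>" using P_image[OF x(1)] by blast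
qed

lemma right_limit_iterate: "right_limit r \<Longrightarrow> right_limit ((F ^^ n) r)"
  by (induction n) (auto intro: right_limit_F)

lemma F_less_iff:
  assumes "right_limit r" "right_limit s"
  shows "F r < F s \<longleftrightarrow> r < s"
  using F_strict_mono[of r s] F_strict_mono[of s r] right_limit_avoids[OF assms(1)] right_limit_avoids[OF assms(2)]
  by (cases r s rule: linorder_cases) auto

lemma P_right_limit: "x \<in> P \<Longrightarrow> right_limit x"
  unfolding right_limit_def by auto

lemma P_below_F:
  assumes "right_limit r" "y \<in> P" "y < F r"
  shows "\<exists>x\<in>P. y = F x \<and> x < r"
proof -
  obtain x where x: "x \<in> P" "F x = y" using P_preimage[OF assms(2)] by blast
  then have "x < r" using F_less_iff[OF P_right_limit[OF x(1)] assms(1)] assms(3) by simp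
  then show ?thesis using x by blast
qed

lemma gap_decreases:
  assumes "right_limit r" "gap r \<gamma>"
  shows "gap (F r) (\<gamma> - \<delta>)"
  unfolding gap_def
proof (intro ballI impI)
  fix y assume "y \<in> P" "y < F r"
  then obtain x where x: "x \<in> P" "y = F x" "x < r" using P_below_F assms(1) by blast
  then have "x \<le> r - \<gamma>" using assms(2) by (auto simp: gap_def)
  then show "y \<le> F r - (\<gamma> - \<delta>)" using x(2) \<delta>_pos by (auto simp: F_def lower_def)
qed

text \<open>The exceptional case for gap persistence: no point of \<open>P\<close> separates \<open>r\<close> from the jump of
  \<open>F\<close> at \<open>c0 + a\<int>\<close> just below it.\<close>

definition at_drop :: "real \<Rightarrow> bool" where
  "at_drop r \<longleftrightarrow> c0 \<le> md r \<and> (\<forall>x\<in>P. x < r \<longrightarrow> x < r - md r + c0)"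

text \<open>If \<open>r\<close> is on the lower branch, \<open>F\<close> moves it at least as far as
  any \<open>x\<close>. Otherwise some \<open>x0\<close> in \<open>P\<close> lies between the drop
  and \<open>r\<close>; then \<open>q = max x x0\<close> is on the branch of \<open>r\<close>, and
  \<open>F x \<le> F q\<close> by monotonicity.\<close>

lemma gap_persists:
  assumes "right_limit r" "gap r \<gamma>" "\<not> at_drop r"
  shows "gap (F r) \<gamma>"
  unfolding gap_def
proof (intro ballI impI)
  fix y assume "y \<in> P" "y < F r"
  then obtain x where x: "x \<in> P" "y = F x" "x < r" using P_below_F assms(1) by blast
  then have le: "x \<le> r - \<gamma>" using assms(2) by (auto simp: gap_def)
  show "y \<le> F r - \<gamma>"
  proof (cases "md r < c0")
    case True
    then show ?thesis using x(2) le \<delta>_pos by (auto simp: F_def lower_def)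
  next
    case False
    then obtain x0 where x0: "x0 \<in> P" "x0 < r" "r - md r + c0 \<le> x0"
      using assms(3) unfolding at_drop_def by force
    define q where "q = max x x0"
    have q: "q \<in> P" "q < r" "r - md r + c0 \<le> q" "x \<le> q" using x x0 by (auto simp: q_def max_def)
    have "md q = md r + (q - r)"
      by (rule md_near) (use q md_bounds[of r] \<delta>_less \<delta>_pos in auto)
    then have "lower q = 0" "lower r = 0" using q False by (auto simp: lower_def)
    moreover have "q \<le> r - \<gamma>" using assms(2) q by (auto simp: gap_def)
    moreover have "F x \<le> F q" using F_less_iff[of q x] P_right_limit x(1) q(1,4) by auto
    ultimately show ?thesis using x(2) by (simp add: F_def)
  qed
qed

text \<open>The points of \<open>P\<close> just before \<open>r\<close> have residue at least
  \<open>c0\<close> in the preceding period, so \<open>F\<close> moves them by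
  \<open>\<delta>\<close> less than it moves \<open>r\<close>.\<close>

lemma gap_increases:
  assumes "right_limit r" "gap r \<gamma>" "md r < c0" "\<And>x. x \<in> P \<Longrightarrow> x < r \<Longrightarrow> x < r - md r"
    and "\<exists>x\<in>P. c0 \<le> md x"
  shows "gap (F r) (\<gamma> + \<delta>)"
  unfolding gap_def
proof (intro ballI impI)
  fix y assume "y \<in> P" "y < F r"
  then obtain x where x: "x \<in> P" "y = F x" "x < r" using P_below_F assms(1) by blast
  obtain z where z: "z \<in> P" "c0 \<le> md z" using assms(5) by blast
  \<comment> \<open>The translate of \<open>z\<close> into the period just before that of
    \<open>r\<close>.\<close>
  define x0 where "x0 = z + a * of_int (\<lfloor>r / a\<rfloor> - \<lfloor>z / a\<rfloor> - 1)"
  have x0: "x0 \<in> P" unfolding x0_def by (rule P_shift) (rule z)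
  have x0_eq: "x0 = md z - a + (r - md r)"
    by (simp add: x0_def residue_def algebra_simps)
  define q where "q = max x x0"
  have q: "q \<in> P" "q < r" "x0 \<le> q" "x \<le> q"
    using x x0 x0_eq md_bounds[of z] md_bounds[of r] by (auto simp: q_def max_def)
  have "q < r - md r" using assms(4) q by blast
  then have "md (q + a * of_int 1) = md r + (q + a * of_int 1 - r)"
    by (intro md_near) (use q x0_eq z \<delta>_less \<delta>_pos in auto)
  then have "md q = md r + (q + a - r)" by (simp add: md_shift[of q 1, simplified])
  then have "lower q = 0" using q x0_eq z by (simp add: lower_def)
  moreover have "q \<le> r - \<gamma>" using assms(2) q by (auto simp: gap_def)
  moreover have "F x \<le> F q" using F_less_iff[of q x] P_right_limit x(1) q(1,4) by auto
  ultimately show "y \<le> F r - (\<gamma> + \<delta>)" using x(2) assms(3) by (simp add: F_def lower_def)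
qed

lemma gap_shift:
  assumes "gap r \<gamma>"
  shows "gap (r + a * of_int j) \<gamma>"
  unfolding gap_def
proof (intro ballI impI)
  fix x assume "x \<in> P" "x < r + a * of_int j"
  then have "x + a * of_int (- j) \<in> P" "x + a * of_int (- j) < r" using P_shift[of x "- j"] by auto
  then show "x \<le> r + a * of_int j - \<gamma>" using assms unfolding gap_def by force
qed

text \<open>Gaps of a fixed size at points that are pairwise distinct modulo \<open>a\<close> would overlap, by the
  pigeonhole principle.\<close>

lemma no_uniform_gap:
  assumes "right_limit r" "0 < \<epsilon>" "\<And>n. n0 \<le> n \<Longrightarrow> gap ((F ^^ n) r) \<epsilon>"
  shows False
proof -
  define f where "f n = \<lfloor>md ((F ^^ (n0 + n)) r) / \<epsilon>\<rfloor>" for n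
  have "range f \<subseteq> {0..\<lfloor>a / \<epsilon>\<rfloor>}"
  proof
    fix y assume "y \<in> range f"
    then obtain n where n: "y = f n" by blast
    have "md ((F ^^ (n0 + n)) r) / \<epsilon> \<le> a / \<epsilon>" "0 \<le> md ((F ^^ (n0 + n)) r) / \<epsilon>"
      using md_bounds[of "(F ^^ (n0 + n)) r"] assms(2) by (simp_all add: divide_right_mono)
    then show "y \<in> {0..\<lfloor>a / \<epsilon>\<rfloor>}" unfolding n f_def by (simp add: floor_mono)
  qed
  then have "finite (range f)" by (rule finite_subset) simp
  then have "\<not> inj f" using finite_imageD infinite_UNIV_nat by blast
  then obtain n k where nk: "n \<noteq> k" "f n = f k" unfolding inj_def by blast
  have *: False if nk: "n \<noteq> k" "f n = f k" "md ((F ^^ (n0 + n)) r) \<le> md ((F ^^ (n0 + k)) r)" for n k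
  proof -
    define x y where "x = (F ^^ (n0 + n)) r" and "y = (F ^^ (n0 + k)) r"
    define y' where "y' = y + a * of_int (\<lfloor>x / a\<rfloor> - \<lfloor>y / a\<rfloor>)"
    have y': "y' = md y + (x - md x)" by (simp add: y'_def residue_def algebra_simps)
    have "x \<noteq> y'" unfolding x_def y_def y'_def
      by (rule F_iterate_not_periodic) (use nk in simp)
    then have "x < y'" using y' nk(3) by (simp add: x_def y_def)
    moreover have "gap y' \<epsilon>" unfolding y'_def y_def by (intro gap_shift assms) simp
    moreover have "right_limit x" unfolding x_def by (rule right_limit_iterate) (rule assms)
    ultimately have "x \<le> y' - \<epsilon>" using gap_separates by blast
    then have "md x + \<epsilon> \<le> md y" using y' by simp
    then have "md x / \<epsilon> + 1 \<le> md y / \<epsilon>"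
      using divide_right_mono[of "md x + \<epsilon>" "md y" \<epsilon>] assms(2) by (simp add: add_divide_distrib)
    then have "\<lfloor>md x / \<epsilon>\<rfloor> + 1 \<le> \<lfloor>md y / \<epsilon>\<rfloor>" by linarith
    then show False using nk(2) by (simp add: f_def x_def y_def)
  qed
  show False using *[of n k] *[of k n] nk by linarith
qed

section \<open>The gap at zero and its orbit\<close>

definition start :: real where "start = Inf {x \<in> P. 0 \<le> x}"

lemma P_md: "x \<in> P \<Longrightarrow> md x \<in> P"
  using P_shift[of x "- \<lfloor>x / a\<rfloor>"] by (simp add: residue_def)

lemma start_props:
  shows "right_limit start" "0 \<le> start" "start < a" "\<And>x. x \<in> P \<Longrightarrow> x < start \<Longrightarrow> x < 0"
proof -
  let ?A = "{x \<in> P. 0 \<le> x}"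
  obtain x where "x \<in> P" using P_nonempty by blast
  then have x: "md x \<in> ?A" using P_md md_bounds by simp
  have bdd: "bdd_below ?A" by (rule bdd_belowI[of _ 0]) simp
  show ge: "0 \<le> start" unfolding start_def by (rule cInf_greatest) (use x in auto)
  have "start \<le> md x" unfolding start_def by (rule cInf_lower[OF x bdd])
  then show "start < a" using md_bounds[of x] by simp
  show less: "x < 0" if "x \<in> P" "x < start" for x
  proof (rule ccontr)
    assume "\<not> x < 0"
    then have "start \<le> x" unfolding start_def using cInf_lower[OF _ bdd] that by simp
    then show False using that by simp
  qed
  show "right_limit start"
    unfolding right_limit_def
  proof (intro allI impI)
    fix \<eta> :: real assume "0 < \<eta>"
    then obtain y where y: "y \<in> ?A" "y < start + \<eta>"
      using cInf_less_iff[of ?A "start + \<eta>"] x bdd unfolding start_def by auto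
    moreover have "start \<le> y" unfolding start_def by (rule cInf_lower[OF y(1) bdd])
    ultimately show "\<exists>x\<in>P. start \<le> x \<and> x < start + \<eta>" by blast
  qed
qed

lemma md_start: "md start = start"
  using md_unique(1)[of start start 0] start_props by simp

text \<open>With \<open>lower\<close> constant, \<open>F\<close> translates \<open>P\<close> rigidly
  and gaps keep their size forever. Together with \<open>no_uniform_gap\<close> this forces
  \<open>P\<close> to meet both branches.\<close>

lemma gap_iterate_const:
  assumes "right_limit r" "gap r \<gamma>" "\<And>x. right_limit x \<Longrightarrow> lower x = v"
  shows "gap ((F ^^ n) r) \<gamma>"
proof (induction n)
  case (Suc n)
  let ?s = "(F ^^ n) r"
  have s: "right_limit ?s" using assms(1) by (rule right_limit_iterate)
  show ?case unfolding gap_def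
  proof (intro ballI impI)
    fix y assume "y \<in> P" "y < (F ^^ Suc n) r"
    then obtain x where x: "x \<in> P" "y = F x" "x < ?s" using P_below_F[OF s] by fastforce
    have "lower x = v" "lower ?s = v" using assms(3) P_right_limit s x by auto
    moreover have "x \<le> ?s - \<gamma>" using Suc x by (auto simp: gap_def)
    ultimately show "y \<le> (F ^^ Suc n) r - \<gamma>" using x(2) F_def[of x] F_def[of ?s] by simp
  qed
qed (use assms in simp)

lemma P_meets_upper: "\<exists>x\<in>P. c0 \<le> md x"
proof (rule ccontr)
  assume none: "\<not> ?thesis"
  have "lower x = 1" if x: "right_limit x" for x
  proof -
    obtain \<eta> where \<eta>: "0 < \<eta>" "\<And>y. x \<le> y \<Longrightarrow> y < x + \<eta> \<Longrightarrow> lower y = lower x"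
      using lower_near[of x] by blast
    then obtain y where "y \<in> P" "x \<le> y" "y < x + \<eta>" using right_limit_between[OF x, of "x + \<eta>"] by auto
    then have "lower y = lower x" "lower y = 1"
      using \<eta>(2)[of y] none by (fastforce simp: lower_def not_le)+
    then show ?thesis by simp
  qed
  \<comment> \<open>If \<open>P\<close> misses the residues in \<open>[c0, a)\<close>, its negative
    points lie below \<open>c0 - a\<close>.\<close>
  moreover have "gap start (a - c0)" unfolding gap_def
  proof (intro ballI impI)
    fix x assume x: "x \<in> P" "x < start"
    then have "x < 0" by (rule start_props)
    then have "\<lfloor>x / a\<rfloor> \<le> -1" using a_pos by (simp add: divide_less_0_iff floor_le_iff)
    then have "real_of_int \<lfloor>x / a\<rfloor> \<le> -1" by linarith
    then have "a * of_int \<lfloor>x / a\<rfloor> \<le> a * (-1)" using a_pos by (intro mult_left_mono) auto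
    moreover have "md x < c0" using none x by auto
    ultimately show "x \<le> start - (a - c0)" using md_decomp[of x] start_props(2) by linarith
  qed
  ultimately have "gap ((F ^^ n) start) (a - c0)" for n
    using gap_iterate_const start_props(1) by blast
  then show False using no_uniform_gap[OF start_props(1), of "a - c0" 0] c0_less by simp
qed

lemma P_meets_lower: "\<exists>x\<in>P. md x < c0"
proof (rule ccontr)
  assume none: "\<not> ?thesis"
  have low: "lower x = 0" if x: "right_limit x" for x
  proof -
    obtain \<eta> where \<eta>: "0 < \<eta>" "\<And>y. x \<le> y \<Longrightarrow> y < x + \<eta> \<Longrightarrow> lower y = lower x"
      using lower_near[of x] by blast
    then obtain y where "y \<in> P" "x \<le> y" "y < x + \<eta>" using right_limit_between[OF x, of "x + \<eta>"] by auto
    then have "lower y = lower x" "lower y = 0"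
      using \<eta>(2)[of y] none by (auto simp: lower_def)
    then show ?thesis by simp
  qed
  have "c0 \<le> start" using low[OF start_props(1)] md_start by (auto simp: lower_def split: if_splits)
  then have "gap start c0" using start_props(4) unfolding gap_def by fastforce
  then have "gap ((F ^^ n) start) c0" for n
    using gap_iterate_const start_props(1) low by blast
  then show False using no_uniform_gap[OF start_props(1), of c0 0] \<delta>_less \<delta>_pos by simp
qed

lemma start_less: "start < c0"
proof -
  obtain x where x: "x \<in> P" "md x < c0" using P_meets_lower by blast
  then have "\<not> md x < start" using start_props(4)[of "md x"] P_md md_bounds[of x] by force
  then show ?thesis using x by simp
qed

text \<open>If two drop points had different residues, a point of \<open>P\<close> approximating the
  one with smaller residue, translated to the period of the other, would lie between the drop and
  that other point.\<close>

lemma at_drop_unique: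
  assumes "right_limit r" "right_limit s" "at_drop r" "at_drop s"
  shows "\<exists>j. r = s + a * of_int j"
proof -
  have *: False if rs: "right_limit r" "at_drop r" "at_drop s" "md r < md s" for r s
  proof -
    obtain x where x: "x \<in> P" "r \<le> x" "x < r + (md s - md r)"
      using right_limit_between[OF rs(1), of "r + (md s - md r)"] rs(4) by auto
    have eq: "x + a * of_int (\<lfloor>s / a\<rfloor> - \<lfloor>r / a\<rfloor>) = x + (s - md s) - (r - md r)"
      by (simp add: residue_def algebra_simps)
    have "x + (s - md s) - (r - md r) \<in> P" unfolding eq[symmetric] using x(1) by (rule P_shift)
    then show False using rs x unfolding at_drop_def by force
  qed
  have "md r = md s" using *[of r s] *[of s r] assms by (cases "md r" "md s" rule: linorder_cases) auto
  then have "r = s + a * of_int (\<lfloor>r / a\<rfloor> - \<lfloor>s / a\<rfloor>)" by (simp add: residue_def algebra_simps)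
  then show ?thesis by blast
qed

abbreviation orb :: "nat \<Rightarrow> real" where "orb n \<equiv> (F ^^ n) start"

lemma right_limit_orb: "right_limit (orb n)"
  by (rule right_limit_iterate[OF start_props(1)])

lemma gap_orb_range:
  assumes "gap (orb n) \<gamma>" "\<And>i. n \<le> i \<Longrightarrow> i < n + k \<Longrightarrow> \<not> at_drop (orb i)"
  shows "gap (orb (n + k)) \<gamma>"
  using assms(2)
proof (induction k)
  case (Suc k)
  then show ?case using gap_persists[OF right_limit_orb, of "n + k" \<gamma>] by simp
qed (use assms in simp)

text \<open>The gap before \<open>start\<close> gains \<open>\<delta>\<close> in the first step and
  can lose length only at the unique later visit to a drop, and then at most
  \<open>\<delta>\<close>. A positive remainder would survive forever, against
  \<open>no_uniform_gap\<close>; this forces the exact positions of both ends of the orbit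
  segment.\<close>

lemma orb_structure:
  obtains D k where "0 < D" "orb 0 = 0" "orb D = c0 + a * of_int k"
    "\<And>n. 1 \<le> n \<Longrightarrow> n \<le> D \<Longrightarrow> gap (orb n) \<delta>"
proof -
  have gap0: "gap (orb 0) start" using start_props(4) by (fastforce simp: gap_def)
  have gap1: "gap (orb 1) (start + \<delta>)"
    using gap_increases[OF start_props(1), of start] gap0 start_less start_props(4) P_meets_upper
    by (simp add: md_start)
  have gap_mono: "gap r \<gamma>'" if "gap r \<gamma>" "\<gamma>' \<le> \<gamma>" for r \<gamma> \<gamma>'
    using that by (force simp: gap_def)
  have ex: "\<exists>n\<ge>1. at_drop (orb n)"
  proof (rule ccontr)
    assume "\<not> ?thesis"
    then have "gap (orb (1 + (n - 1))) (start + \<delta>)" if "1 \<le> n" for n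
      using gap_orb_range[OF gap1, of "n - 1"] by blast
    then have "gap (orb n) \<delta>" if "1 \<le> n" for n
      using gap_mono start_props(2) that by (metis add_increasing le_add_diff_inverse order_refl)
    then show False using no_uniform_gap[OF start_props(1) \<delta>_pos, of 1] by blast
  qed
  define D where "D = (LEAST n. 1 \<le> n \<and> at_drop (orb n))"
  have D: "1 \<le> D" "at_drop (orb D)" using LeastI_ex[OF ex[unfolded Bex_def]] by (auto simp: D_def)
  have unique: "\<not> at_drop (orb n)" if "n \<noteq> D" for n
    using at_drop_unique[OF right_limit_orb right_limit_orb _ D(2), of n]
      F_iterate_not_periodic[OF that] by blast
  have gap_le: "gap (orb n) (start + \<delta>)" if "1 \<le> n" "n \<le> D" for n
    using gap_orb_range[OF gap1, of "n - 1"] unique that by simp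
  have gap_gt: "gap (orb n) \<gamma>" if "gap (orb D) (\<gamma> + \<delta>)" "D < n" for n \<gamma>
  proof -
    have "gap (orb (Suc D)) \<gamma>"
      using gap_decreases[OF right_limit_orb that(1)] by simp
    from gap_orb_range[OF this, of "n - Suc D"] show ?thesis using unique that by simp
  qed
  \<comment> \<open>Used twice: the excess \<open>start\<close> gives \<open>start = 0\<close>, and
    the excess \<open>md (orb D) - c0\<close> gives that the orbit hits residue \<open>c0\<close>
    exactly.\<close>
  have zero: "\<gamma> \<le> 0" if "gap (orb D) (\<gamma> + \<delta>)" for \<gamma>
    using no_uniform_gap[OF start_props(1), of \<gamma> "Suc D"] gap_gt[OF that] by fastforce
  have "start = 0" using zero[OF gap_le] D start_props(2) by simp
  moreover define \<gamma> where "\<gamma> = md (orb D) - c0"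
  \<comment> \<open>No point of \<open>P\<close> lies between the drop and \<open>orb D\<close>, and
    none in the forbidden arc of length \<open>\<delta>\<close> before the drop.\<close>
  have "gap (orb D) (\<gamma> + \<delta>)" unfolding gap_def
  proof (intro ballI impI)
    fix x assume x: "x \<in> P" "x < orb D"
    define r where "r = orb D"
    have lt: "x < r - md r + c0" using D(2) x by (simp add: at_drop_def r_def)
    show "x \<le> orb D - (\<gamma> + \<delta>)"
    proof (rule ccontr)
      assume "\<not> ?thesis"
      then have gt: "r - md r + c0 - \<delta> < x" by (simp add: \<gamma>_def r_def)
      have "md x = md r + (x - r)"
        by (rule md_near) (use lt gt \<delta>_less c0_less in auto)
      then show False using P_avoids[OF x(1)] lt gt by auto
    qed
  qed
  then have "md (orb D) = c0" using zero[of \<gamma>] D(2) by (simp add: \<gamma>_def at_drop_def)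
  then have "orb D = c0 + a * of_int \<lfloor>orb D / a\<rfloor>" using md_decomp[of "orb D"] by simp
  ultimately show ?thesis using that[of D "\<lfloor>orb D / a\<rfloor>"] D(1) gap_le by simp
qed

end

section \<open>Collapsing a cycle of gaps\<close>

text \<open>Only a finite orbit segment is retained from \<open>P\<close>: \<open>r_sep\<close>
  records the gap before each \<open>r n\<close>, and \<open>r_order\<close> the monotonicity of
  \<open>F\<close> on translates of the segment.\<close>

locale gap_cycle = gap_map +
  fixes r :: "nat \<Rightarrow> real" and D :: nat and k :: int
  assumes D_pos: "0 < D" and r_0: "r 0 = 0" and r_Suc: "\<And>n. n < D \<Longrightarrow> r (Suc n) = F (r n)"
    and r_D: "r D = c0 + a * of_int k"
    and r_sep: "\<And>n i j. 1 \<le> n \<Longrightarrow> n \<le> D \<Longrightarrow> i \<le> D \<Longrightarrow> r i + a * of_int j < r n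
      \<Longrightarrow> r i + a * of_int j \<le> r n - \<delta>"
    and r_order: "\<And>n i j. n < D \<Longrightarrow> i < D
      \<Longrightarrow> r (Suc i) + a * of_int j \<le> r (Suc n) \<longleftrightarrow> r i + a * of_int j \<le> r n"
begin

lemma r_iterate: "n \<le> D \<Longrightarrow> r n = (F ^^ n) 0"
  by (induction n) (auto simp: r_0 r_Suc)

definition s :: "nat \<Rightarrow> real" where "s n = md (r n)"

lemma s_0: "s 0 = 0"
  by (simp add: s_def r_0 residue_def)

lemma s_D: "s D = c0"
  using md_unique(1)[of "r D" c0 k] r_D \<delta>_pos \<delta>_less c0_less by (simp add: s_def)

lemma s_bounds: "0 \<le> s n" "s n < a"
  by (simp_all add: s_def md_bounds)

lemma r_decomp: "r n = s n + a * of_int \<lfloor>r n / a\<rfloor>"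
  using md_decomp[of "r n"] by (simp add: s_def)

lemma s_inj: "inj_on s {..D}"
proof (rule inj_onI, rule ccontr)
  fix n i assume H: "n \<in> {..D}" "i \<in> {..D}" "s n = s i" "n \<noteq> i"
  have "r n = r i + a * of_int (\<lfloor>r n / a\<rfloor> - \<lfloor>r i / a\<rfloor>)"
    using r_decomp[of n] r_decomp[of i] H(3) by (simp add: algebra_simps)
  moreover have "r n = (F ^^ n) 0" "r i = (F ^^ i) 0" using r_iterate H by auto
  ultimately show False using F_iterate_not_periodic[OF H(4), of 0 "\<lfloor>r n / a\<rfloor> - \<lfloor>r i / a\<rfloor>"] by simp
qed

lemma s_sep:
  assumes "n \<le> D" "i \<le> D" "s i < s n"
  shows "s i + \<delta> \<le> s n"
proof -
  have "n \<noteq> 0" using assms(3) s_0 s_bounds(1)[of i] by (metis not_le)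
  have eq: "r i + a * of_int (\<lfloor>r n / a\<rfloor> - \<lfloor>r i / a\<rfloor>) = r n - s n + s i"
    using r_decomp[of n] r_decomp[of i] by (simp add: algebra_simps)
  have "r i + a * of_int (\<lfloor>r n / a\<rfloor> - \<lfloor>r i / a\<rfloor>) \<le> r n - \<delta>"
    by (rule r_sep) (use \<open>n \<noteq> 0\<close> assms eq in auto)
  then show ?thesis unfolding eq by simp
qed

lemma s_pos: "1 \<le> n \<Longrightarrow> n \<le> D \<Longrightarrow> 0 < s n"
  using inj_onD[OF s_inj, of n 0] s_0 s_bounds(1)[of n] by force

lemma s_packing:
  assumes "I \<subseteq> {1..D}" "m \<le> D" "s m \<le> y" "\<And>i. i \<in> I \<Longrightarrow> s m < s i \<and> s i \<le> y"
  shows "\<delta> * of_nat (card I) \<le> y - s m"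
proof -
  have sub: "I \<subseteq> {..D}" using assms(1) by auto
  have "card (s ` I) = card I" by (rule card_image) (rule inj_on_subset[OF s_inj sub])
  moreover have "\<delta> * of_nat (card (s ` I)) \<le> y - s m"
  proof (rule packing_bound)
    show "finite (s ` I)" using finite_subset[OF sub] by simp
    show "s m + \<delta> \<le> z \<and> z \<le> y" if "z \<in> s ` I" for z
      using that s_sep[OF _ assms(2)] assms(4) sub by blast
    show "z + \<delta> \<le> z'" if "z \<in> s ` I" "z' \<in> s ` I" "z < z'" for z z'
      using that s_sep sub by blast
  qed (use \<delta>_pos assms in auto)
  ultimately show ?thesis by simp
qed

text \<open>Packing up to the largest of the finitely many points, which is still below
  \<open>y\<close>, makes the bound strict.\<close>

lemma s_packing_strict:
  assumes "I \<subseteq> {1..D}" "m \<le> D" "s m < y" "\<And>i. i \<in> I \<Longrightarrow> s m < s i \<and> s i < y"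
  shows "\<delta> * of_nat (card I) < y - s m"
proof -
  have fin: "finite (s ` insert m I)" using finite_subset[OF assms(1)] by simp
  define y' where "y' = Max (s ` insert m I)"
  have le: "s i \<le> y'" if "i \<in> insert m I" for i
    unfolding y'_def using fin that by (intro Max_ge) auto
  have "y' \<in> s ` insert m I" unfolding y'_def by (rule Max_in[OF fin]) simp
  then have "y' < y" using assms(3,4) by auto
  moreover have "\<delta> * of_nat (card I) \<le> y' - s m"
    by (rule s_packing) (use assms le in auto)
  ultimately show ?thesis by simp
qed

definition d1 :: nat where "d1 = card {n \<in> {1..D}. s n < c0}"

definition d2 :: nat where "d2 = card {n \<in> {1..D}. c0 < s n}"

lemma s_eq_c0_iff: "n \<le> D \<Longrightarrow> s n = c0 \<longleftrightarrow> n = D"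
  using inj_onD[OF s_inj, of n D] s_D by auto

lemma card_le_c0: "card {n \<in> {1..D}. s n \<le> c0} = d1 + 1"
proof -
  have "{n \<in> {1..D}. s n \<le> c0} = insert D {n \<in> {1..D}. s n < c0}"
    using s_eq_c0_iff D_pos s_D by force
  then show ?thesis using s_D by (simp add: d1_def)
qed

lemma D_eq: "D = d1 + d2 + 1"
proof -
  have "card {n \<in> {1..D}. True} = card {n \<in> {1..D}. s n \<le> c0} + card {n \<in> {1..D}. c0 < s n}"
    by (rule card_Collect_split) auto
  then show ?thesis unfolding card_le_c0 d2_def by (simp del: atLeastAtMost_iff)
qed

lemma r_eq_sum: "n \<le> D \<Longrightarrow> r n = of_nat n * c1 + \<delta> * (\<Sum>i<n. lower (r i))"
  by (induction n) (simp_all add: r_0 r_Suc F_def algebra_simps)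

lemma cycle_eq: "of_nat D * c1 + (of_nat d1 + 1) * \<delta> = c0 + a * of_int k"
proof -
  have "(\<Sum>i<D. lower (r i)) = of_nat (card ({..<D} \<inter> {i. s i < c0}))"
    by (simp add: lower_def s_def sum.If_cases)
  \<comment> \<open>Index 0 accounts for the extra 1, as \<open>s 0 = 0\<close>; index
    \<open>D\<close> drops out, as \<open>s D = c0\<close>.\<close>
  also have "{..<D} \<inter> {i. s i < c0} = insert 0 {n \<in> {1..D}. s n < c0}"
    using s_0 s_D \<delta>_pos \<delta>_less D_pos by (auto simp: Suc_le_eq order_le_less)
  also have "card \<dots> = d1 + 1" by (simp add: d1_def)
  finally show ?thesis using r_eq_sum[of D] r_D by (simp add: algebra_simps)
qed

lemma d1_bound: "(of_nat d1 + 1) * \<delta> < c0"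
proof -
  have "\<delta> * of_nat (card {n \<in> {1..D}. s n \<le> c0}) \<le> c0 - s 0"
    by (rule s_packing) (use s_pos s_0 \<delta>_pos \<delta>_less in auto)
  then have "(of_nat d1 + 1) * \<delta> \<le> c0" unfolding card_le_c0 by (simp add: s_0 algebra_simps)
  \<comment> \<open>By \<open>cycle_eq\<close>, equality would make \<open>D * c1\<close> a multiple
    of \<open>a\<close>.\<close>
  moreover have "(of_nat d1 + 1) * \<delta> \<noteq> c0" using cycle_eq c1_multiple_not_lattice[OF D_pos, of 0 k] by auto
  ultimately show ?thesis by simp
qed

lemma d2_bound: "of_nat d2 * \<delta> < a - c0"
proof -
  have "\<delta> * of_nat (card {n \<in> {1..D}. c0 < s n}) < a - s D"
    by (rule s_packing_strict) (use s_bounds s_D c0_less in auto)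
  then show ?thesis by (simp add: d2_def s_D mult.commute)
qed

section \<open>The collapsed circle and its rotation\<close>

definition L :: real where "L = a - of_nat D * \<delta>"

definition \<theta> :: real where "\<theta> = c1 - of_int k * \<delta>"

text \<open>The length of the arc \<open>[0, c0)\<close> after collapsing; its \<open>d1 + 1\<close>
  gaps include \<open>[c0 - \<delta>, c0)\<close>.\<close>

definition l :: real where "l = c0 - (of_nat d1 + 1) * \<delta>"

lemma l_bounds: "0 < l" "l < L"
  using d1_bound d2_bound arg_cong[OF D_eq, of real] by (simp_all add: l_def L_def algebra_simps)

text \<open>A relation forces \<open>j = q * p\<close> and \<open>k = N + p * D\<close>. Then
  \<open>cycle_eq\<close> reads \<open>D * N * \<delta> = l + a * N\<close>, which is impossible
  since \<open>D * \<delta> < a\<close> and \<open>0 < l\<close>.\<close>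

lemma rotation_irrational:
  assumes "0 < q"
  shows "of_nat q * \<theta> \<noteq> L * of_int j"
proof
  assume "of_nat q * \<theta> = L * of_int j"
  then have *: "of_int (int q * (N - k) + j * int D) * \<delta> = of_int (j - int q * p) * a"
    unfolding \<theta>_def L_def using c1_eq by (simp add: algebra_simps)
  then have 1: "int q * (N - k) + j * int D = 0" by (rule irrational)
  with * have "of_int (j - int q * p) * a = 0" by simp
  then have "j = int q * p" using a_pos by (simp only: mult_eq_0_iff of_int_eq_0_iff) simp
  with 1 have "int q * (N - k + p * int D) = 0" by (simp add: algebra_simps)
  then have k: "k = N + p * int D" using assms by simp
  have "of_nat D * of_int N * \<delta> = l + a * of_int N"
    using cycle_eq unfolding k by (simp add: c1_eq l_def algebra_simps)
  moreover have "(of_nat D * \<delta>) * of_int N \<le> a * of_int N"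
    by (rule mult_right_mono) (use l_bounds N_pos in \<open>auto simp: L_def\<close>)
  ultimately show False using l_bounds(1) by (simp add: algebra_simps)
qed

text \<open>Relative to a fixed origin, this counts the gap endpoints on the line up to
  \<open>r n\<close>. The form as a sum of floors makes it telescope under one step of
  \<open>F\<close>.\<close>

definition cnt :: "nat \<Rightarrow> int" where "cnt n = (\<Sum>i<D. \<lfloor>(r n - r (Suc i)) / a\<rfloor>)"

lemma floor_r_Suc:
  assumes "n < D" "i < D"
  shows "\<lfloor>(r (Suc n) - r (Suc i)) / a\<rfloor> = \<lfloor>(r n - r i) / a\<rfloor>"
proof -
  have le: "j \<le> \<lfloor>(x - y) / a\<rfloor> \<longleftrightarrow> y + a * of_int j \<le> x" for x y j
    using a_pos by (simp add: le_floor_iff pos_le_divide_eq algebra_simps)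
  have "j \<le> \<lfloor>(r (Suc n) - r (Suc i)) / a\<rfloor> \<longleftrightarrow> j \<le> \<lfloor>(r n - r i) / a\<rfloor>" for j
    unfolding le using r_order[OF assms] by simp
  then show ?thesis by (meson antisym order_refl)
qed

text \<open>By \<open>floor_r_Suc\<close> both indices can be lowered together, so only the terms of
  \<open>r 0\<close> and \<open>r D\<close> survive. The latter has residue \<open>c0\<close>, which
  produces \<open>k\<close> and the indicator.\<close>

lemma cnt_Suc:
  assumes "n < D"
  shows "cnt (Suc n) = cnt n + k + (if s n < c0 then 1 else 0)"
proof -
  let ?f = "\<lambda>i. \<lfloor>(r n - r i) / a\<rfloor>"
  have "cnt (Suc n) - cnt n = (\<Sum>i<D. ?f i - ?f (Suc i))"
    unfolding cnt_def sum_subtractf[symmetric]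
    by (rule sum.cong) (use floor_r_Suc[OF assms] in auto)
  also have "\<dots> = ?f 0 - ?f D" by (rule sum_lessThan_telescope')
  also have "?f D = \<lfloor>r n / a\<rfloor> - k - (if s n < c0 then 1 else 0)"
    using floor_diff_divide[OF a_pos, of "r n" "r D"] s_D
      md_unique(2)[of "r D" c0 k] r_D \<delta>_pos \<delta>_less c0_less by (simp add: s_def)
  finally show ?thesis by (simp add: r_0)
qed

text \<open>Collapsing the gaps turns \<open>F\<close> into the rotation by \<open>\<theta>\<close> modulo \<open>L\<close>.\<close>

lemma collapse_r:
  assumes "n \<le> D"
  shows "of_nat n * \<theta> = r n - \<delta> * of_int (cnt n - cnt 0)"
  using assms
proof (induction n)
  case (Suc n)
  then show ?case using cnt_Suc[of n] r_Suc[of n]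
    by (simp add: F_def lower_def s_def \<theta>_def algebra_simps split: if_splits)
qed (simp add: r_0)

lemma cnt_diff:
  "cnt n - cnt 0 = int D * \<lfloor>r n / a\<rfloor> + int (card {i \<in> {1..D}. s i \<le> s n})"
proof -
  have "\<lfloor>(r n - r (Suc i)) / a\<rfloor> - \<lfloor>(r 0 - r (Suc i)) / a\<rfloor>
      = \<lfloor>r n / a\<rfloor> + (if s (Suc i) \<le> s n then 1 else 0)" if "i < D" for i
    using floor_diff_divide[OF a_pos, of "r n" "r (Suc i)"] floor_diff_divide[OF a_pos, of "r 0" "r (Suc i)"]
      s_pos[of "Suc i"] s_0 that r_0 by (auto simp: s_def)
  then have "cnt n - cnt 0 = (\<Sum>i<D. \<lfloor>r n / a\<rfloor> + (if s (Suc i) \<le> s n then 1 else 0))"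
    unfolding cnt_def sum_subtractf[symmetric] by (intro sum.cong) auto
  also have "\<dots> = int D * \<lfloor>r n / a\<rfloor> + (\<Sum>i\<in>{1..D}. if s i \<le> s n then 1 else 0)"
    by (simp add: sum.distrib sum.atLeast1_atMost_eq)
  also have "(\<Sum>i\<in>{1..D}. if s i \<le> s n then 1 else 0) = int (card {i \<in> {1..D}. s i \<le> s n})"
    by (simp add: sum.If_cases Int_def)
  finally show ?thesis .
qed

text \<open>The collapsed position of \<open>r n\<close> is \<open>y\<close>. Packing the gaps on
  either side of \<open>s n\<close> places it in \<open>[0, L)\<close>, and packing those between
  \<open>s n\<close> and \<open>c0\<close> compares it with \<open>l\<close>.\<close>

lemma rotation_residue:
  assumes "1 \<le> n" "n \<le> D"
  shows "residue L (of_nat n * \<theta>) < l \<longleftrightarrow> s n < c0"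
proof -
  define C where "C = card {i \<in> {1..D}. s i \<le> s n}"
  define y where "y = s n - \<delta> * of_nat C"
  have eq: "of_nat n * \<theta> = y + L * of_int \<lfloor>r n / a\<rfloor>"
    using collapse_r[OF assms(2)] cnt_diff[of n] r_decomp[of n]
    by (simp add: y_def C_def L_def algebra_simps)
  have "\<delta> * of_nat (card {i \<in> {1..D}. s i \<le> s n}) \<le> s n - s 0"
    by (rule s_packing) (use s_pos s_0 s_bounds in auto)
  then have y_ge: "0 \<le> y" by (simp add: y_def C_def s_0)
  have "\<delta> * of_nat (card {i \<in> {1..D}. s n < s i}) < a - s n"
    by (rule s_packing_strict) (use s_bounds assms in auto)
  moreover have "card {i \<in> {1..D}. True} = C + card {i \<in> {1..D}. s n < s i}"
    unfolding C_def by (rule card_Collect_split) auto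
  then have "C + card {i \<in> {1..D}. s n < s i} = D" by (simp del: atLeastAtMost_iff)
  then have "real D = real C + real (card {i \<in> {1..D}. s n < s i})" by linarith
  ultimately have y_less: "y < L" by (simp add: y_def L_def algebra_simps)
  have res: "residue L (of_nat n * \<theta>) = y"
    by (rule residue_unique(1)[OF _ eq]) (use y_ge y_less l_bounds in auto)
  show ?thesis
  proof (cases "s n < c0")
    case True
    have "\<delta> * of_nat (card {i \<in> {1..D}. s n < s i \<and> s i \<le> c0}) \<le> c0 - s n"
      by (rule s_packing) (use assms True in auto)
    moreover have "card {n \<in> {1..D}. s n \<le> c0} = C + card {i \<in> {1..D}. s n < s i \<and> s i \<le> c0}"
      unfolding C_def by (rule card_Collect_split) (use True in auto)
    then have "real C + real (card {i \<in> {1..D}. s n < s i \<and> s i \<le> c0}) = real d1 + 1"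
      unfolding card_le_c0 by linarith
    then have "real d1 = real C + real (card {i \<in> {1..D}. s n < s i \<and> s i \<le> c0}) - 1" by simp
    ultimately have "y \<le> l" by (simp add: y_def l_def algebra_simps)
    \<comment> \<open>Packing gives only a weak inequality. Equality would put
      \<open>n * \<theta>\<close> and \<open>D * \<theta>\<close> into the same class modulo
      \<open>L\<close>.\<close>
    moreover have "y \<noteq> l"
    proof
      assume "y = l"
      have "n < D" using True assms s_D by (cases "n = D") auto
      have "of_nat D * \<theta> = l + L * of_int k"
        using cycle_eq by (simp add: \<theta>_def l_def L_def algebra_simps)
      then have "of_nat (D - n) * \<theta> = L * of_int (k - \<lfloor>r n / a\<rfloor>)"
        using eq \<open>y = l\<close> \<open>n < D\<close> by (simp add: of_nat_diff algebra_simps)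
      moreover have "0 < D - n" using \<open>n < D\<close> by simp
      ultimately show False using rotation_irrational by blast
    qed
    ultimately show ?thesis using res True by simp
  next
    case False
    have "\<delta> * of_nat (card {i \<in> {1..D}. c0 < s i \<and> s i \<le> s n}) \<le> s n - s D"
      by (rule s_packing) (use assms False s_D in auto)
    moreover have "C = card {n \<in> {1..D}. s n \<le> c0} + card {i \<in> {1..D}. c0 < s i \<and> s i \<le> s n}"
      unfolding C_def by (rule card_Collect_split) (use False in auto)
    then have "real C = real d1 + 1 + real (card {i \<in> {1..D}. c0 < s i \<and> s i \<le> s n})"
      unfolding card_le_c0 by linarith
    ultimately have "l \<le> y" by (simp add: y_def l_def s_D algebra_simps)
    then show ?thesis using res False by simp
  qed
qed

lemma card_rotation:
  "card {n :: int. 1 \<le> n \<and> n \<le> int D \<and> of_int n * \<theta> \<in> plus_lattice {0..<l} L} = d1"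
proof -
  have "{n :: int. 1 \<le> n \<and> n \<le> int D \<and> of_int n * \<theta> \<in> plus_lattice {0..<l} L}
      = int ` {n \<in> {1..D}. s n < c0}" (is "?A = ?B")
  proof (intro equalityI subsetI)
    fix n assume n: "n \<in> ?A"
    then have "n = int (nat n)" "1 \<le> nat n" "nat n \<le> D" by auto
    moreover have "residue L (of_int n * \<theta>) < l"
      using n mem_plus_lattice_iff[of L l] l_bounds by auto
    ultimately show "n \<in> ?B" using rotation_residue[of "nat n"] by (intro image_eqI[of _ _ "nat n"]) auto
  next
    fix n assume "n \<in> ?B"
    then obtain i where i: "n = int i" "1 \<le> i" "i \<le> D" "s i < c0" by auto
    then have "residue L (of_nat i * \<theta>) < l" using rotation_residue by blast
    then show "n \<in> ?A" using i mem_plus_lattice_iff[of L l] l_bounds by auto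
  qed
  then show ?thesis by (simp add: card_image d1_def)
qed

end

context gap_orbit begin

lemma ex_cycle: "\<exists>D k. gap_cycle a \<delta> c0 c1 N p orb D k"
proof -
  obtain D k where D: "0 < D" "orb 0 = 0" "orb D = c0 + a * of_int k"
    "\<And>n. 1 \<le> n \<Longrightarrow> n \<le> D \<Longrightarrow> gap (orb n) \<delta>" by (rule orb_structure) blast
  have "gap_cycle a \<delta> c0 c1 N p orb D k"
  proof
    show "orb i + a * of_int j \<le> orb n - \<delta>"
      if "1 \<le> n" "n \<le> D" "i \<le> D" "orb i + a * of_int j < orb n" for n i j
      using gap_separates[OF right_limit_shift[OF right_limit_orb] D(4)] that by blast
    show "orb (Suc i) + a * of_int j \<le> orb (Suc n) \<longleftrightarrow> orb i + a * of_int j \<le> orb n" for n i j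
      using F_less_iff[OF right_limit_orb[of n] right_limit_shift[OF right_limit_orb[of i], of j]]
      by (simp add: F_shift linorder_not_less[symmetric])
  qed (use D in auto)
  then show ?thesis by blast
qed

end

section \<open>Window tilings\<close>

text \<open>A row has finite support because \<open>b\<close> is positive, and for a 0-1 vector the
  row sum counts the selected points in the window.\<close>

lemma Mmult_eq_1_iff:
  assumes "0 < b" "\<And>k. x k \<in> {0, 1}"
  shows "Mmult a b c t x j = 1 \<longleftrightarrow> (\<exists>!k. t - a * of_int j + b * of_int k \<in> {0..<c} \<and> x k = 1)"
proof -
  define u where "u = t - a * of_int j"
  define K where "K = {k :: int. u + b * of_int k \<in> {0..<c}}"
  have "K \<subseteq> {\<lfloor>- u / b\<rfloor>..\<lceil>(c - u) / b\<rceil>}"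
  proof
    fix k assume "k \<in> K"
    then have "- u \<le> of_int k * b" "of_int k * b \<le> c - u" by (auto simp: K_def algebra_simps)
    then have "- u / b \<le> of_int k" "of_int k \<le> (c - u) / b"
      using pos_divide_le_eq[OF assms(1)] pos_le_divide_eq[OF assms(1)] by blast+
    then show "k \<in> {\<lfloor>- u / b\<rfloor>..\<lceil>(c - u) / b\<rceil>}" by simp linarith
  qed
  then have fin: "finite K" by (rule finite_subset) simp
  have "Mmult a b c t x j = (\<Sum>k\<in>K. x k)"
    unfolding Mmult_def by (rule sum.cong) (auto simp: K_def u_def Mentry_def)
  also have "\<dots> = (\<Sum>k\<in>K. if x k = 1 then 1 else 0)"
    by (rule sum.cong) (use assms(2) in auto)
  also have "\<dots> = of_nat (card (K \<inter> {k. x k = 1}))" using fin by (simp add: sum.If_cases)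
  finally have "Mmult a b c t x j = 1 \<longleftrightarrow> card (K \<inter> {k. x k = 1}) = 1" by simp
  also have "\<dots> \<longleftrightarrow> (\<exists>!k. k \<in> K \<inter> {k. x k = 1})"
    unfolding One_nat_def card_1_singleton_iff set_eq_iff singleton_iff by metis
  finally show ?thesis by (simp add: K_def u_def)
qed

locale window_tiling =
  fixes a b c0 :: real and N :: int and T :: "real set"
  assumes a_pos: "0 < a" and a_less: "a < b" and c0_gt: "b - a < c0" and c0_less: "c0 < a" and N_pos: "1 \<le> N"
    and T_nonempty: "T \<noteq> {}"
    and T_coset: "\<And>x y. x \<in> T \<Longrightarrow> y \<in> T \<Longrightarrow> \<exists>k :: int. y = x + b * of_int k"
    and T_window: "\<And>j :: int. \<exists>!x. x \<in> T \<and> a * of_int j \<le> x \<and> x < a * of_int j + (of_int N * b + c0)"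
begin

abbreviation c :: real where "c \<equiv> of_int N * b + c0"

lemma c_gt: "a < c"
proof -
  have "1 * b \<le> of_int N * b" by (rule mult_right_mono) (use N_pos a_pos a_less in auto)
  then show ?thesis using a_less c0_gt by simp
qed

text \<open>The point \<open>y\<close> of window \<open>j + 1\<close> cannot lie in window
  \<open>j\<close>, which already contains \<open>x\<close>. So \<open>y\<close> lies in a stretch
  of length \<open>a < b\<close> beyond window \<open>j\<close>, leaving only the steps
  \<open>N\<close> and \<open>N + 1\<close>.\<close>

lemma T_next:
  assumes "x \<in> T"
  shows "residue a x \<notin> {c0 - (b - a)..<c0}"
    and "x + b * of_int (N + (if residue a x < c0 then 1 else 0)) \<in> T" (is "?y \<in> T")
    and "a * of_int (\<lfloor>x / a\<rfloor> + 1) \<le> x + b * of_int (N + (if residue a x < c0 then 1 else 0))"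
    and "x + b * of_int (N + (if residue a x < c0 then 1 else 0)) < a * of_int (\<lfloor>x / a\<rfloor> + 1) + c"
proof -
  define j where "j = \<lfloor>x / a\<rfloor>"
  define u where "u = residue a x"
  have x: "x = u + a * of_int j" "0 \<le> u" "u < a"
    using residue_decomp[of x a] residue_bounds[OF a_pos, of x] by (simp_all add: u_def j_def)
  obtain y where y: "y \<in> T" "a * of_int (j + 1) \<le> y" "y < a * of_int (j + 1) + c"
    using T_window[of "j + 1"] by blast
  have "a * of_int j + c \<le> y"
  proof (rule ccontr)
    assume "\<not> ?thesis"
    then have "y \<in> T \<and> a * of_int j \<le> y \<and> y < a * of_int j + c"
      "x \<in> T \<and> a * of_int j \<le> x \<and> x < a * of_int j + c"
      using y x a_pos c_gt assms by (auto simp: algebra_simps)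
    then have "x = y" using T_window[of j] by blast
    then show False using y x by (simp add: algebra_simps)
  qed
  obtain k where k: "y = x + b * of_int k" using T_coset[OF assms y(1)] by blast
  have lo: "c0 - u \<le> b * of_int (k - N)" and hi: "b * of_int (k - N) < c0 - u + a"
    using \<open>a * of_int j + c \<le> y\<close> y(3) k x(1) by (simp_all add: algebra_simps)
  have "b * of_int (k - N) < b * of_int 2" using hi x(2) c0_less a_less by simp
  then have 1: "k - N < 2" using a_pos a_less by (simp only: mult_less_cancel_left_pos of_int_less_iff)
  have "b * of_int (- 1) < b * of_int (k - N)" using lo x(3) c0_gt a_less by simp
  then have "- 1 < k - N" using a_pos a_less by (simp only: mult_less_cancel_left_pos of_int_less_iff)
  with 1 have "k = N \<or> k = N + 1" by linarith
  then have "u \<notin> {c0 - (b - a)..<c0}" and k': "k = N + (if u < c0 then 1 else 0)"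
    using lo hi a_less by auto
  then show "residue a x \<notin> {c0 - (b - a)..<c0}" by (simp add: u_def)
  have "y = ?y" using k k' by (simp add: u_def)
  then show "?y \<in> T" "a * of_int (\<lfloor>x / a\<rfloor> + 1) \<le> ?y" "?y < a * of_int (\<lfloor>x / a\<rfloor> + 1) + c"
    using y by (simp_all add: j_def)
qed

text \<open>Choose \<open>j\<close> such that \<open>y\<close> lies in window \<open>j + 1\<close>
  beyond the end of window \<open>j\<close>. The point of window \<open>j\<close> must have left
  window \<open>j + 1\<close>, so its successor is the only point there, namely
  \<open>y\<close>.\<close>

lemma T_previous:
  assumes "y \<in> T"
  shows "\<exists>x\<in>T. y = x + b * of_int (N + (if residue a x < c0 then 1 else 0))"
proof -
  define j where "j = \<lfloor>(y - c) / a\<rfloor>"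
  have y: "a * of_int j + c \<le> y" "y < a * of_int (j + 1) + c"
    using residue_bounds[OF a_pos, of "y - c"] by (simp_all add: residue_def j_def algebra_simps)
  obtain x where x: "x \<in> T" "a * of_int j \<le> x" "x < a * of_int j + c"
    using T_window[of j] by blast
  have y1: "y \<in> T \<and> a * of_int (j + 1) \<le> y \<and> y < a * of_int (j + 1) + c"
    using y c_gt assms by (auto simp: algebra_simps)
  have "x < a * of_int (j + 1)"
  proof (rule ccontr)
    assume "\<not> ?thesis"
    then have "x \<in> T \<and> a * of_int (j + 1) \<le> x \<and> x < a * of_int (j + 1) + c"
      using x a_pos by (auto simp: algebra_simps)
    then have "x = y" using y1 T_window[of "j + 1"] by blast
    then show False using x y by simp
  qed
  then have "\<lfloor>x / a\<rfloor> = j"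
    using residue_unique(2)[OF a_pos, of x "x - a * of_int j" j] x(2) by (simp add: algebra_simps)
  then have "x + b * of_int (N + (if residue a x < c0 then 1 else 0)) = y"
    using T_next[OF x(1)] y1 T_window[of "j + 1"] by metis
  then show ?thesis using x(1) by blast
qed

lemma gap_orbitI:
  assumes "gap_map a (b - a) c0 c1 N p"
  shows "gap_orbit a (b - a) c0 c1 N p {x + a * of_int j | x j. x \<in> T}"
proof -
  interpret gap_map a "b - a" c0 c1 N p by (rule assms)
  let ?P = "{x + a * of_int j | x j. x \<in> T}"
  \<comment> \<open>The map \<open>F\<close> is the successor in \<open>T\<close> up to a multiple
    of \<open>a\<close>.\<close>
  have F_eq: "F x = x + b * of_int (N + (if residue a x < c0 then 1 else 0))
      + a * of_int (p - N - (if residue a x < c0 then 1 else 0))" for x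
    using c1_eq by (simp add: F_def lower_def algebra_simps)
  show ?thesis
  proof
    show "?P \<noteq> {}" using T_nonempty by blast
    show "x + a * of_int j \<in> ?P" if x: "x \<in> ?P" for x j
    proof -
      obtain y i where "x = y + a * of_int i" "y \<in> T" using x by blast
      then have "x + a * of_int j = y + a * of_int (i + j)" "y \<in> T" by (simp_all add: algebra_simps)
      then show ?thesis by blast
    qed
    show "md x \<notin> {c0 - (b - a)..<c0}" if x: "x \<in> ?P" for x
      using x T_next(1) by auto
    show "F x \<in> ?P" if x: "x \<in> ?P" for x
    proof -
      obtain y i where y: "x = y + a * of_int i" "y \<in> T" using x by blast
      have "F x = (y + b * of_int (N + (if residue a y < c0 then 1 else 0)))
          + a * of_int (p - N - (if residue a y < c0 then 1 else 0) + i)"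
        using F_shift[of y i] F_eq[of y] unfolding y(1) by (simp add: algebra_simps)
      then show ?thesis using T_next(2)[OF y(2)] by blast
    qed
    show "\<exists>y\<in>?P. F y = x" if x: "x \<in> ?P" for x
    proof -
      obtain y i where y: "x = y + a * of_int i" "y \<in> T" using x by blast
      obtain z where z: "z \<in> T" "y = z + b * of_int (N + (if residue a z < c0 then 1 else 0))"
        using T_previous[OF y(2)] by blast
      define i' where "i' = i - (p - N - (if residue a z < c0 then 1 else 0))"
      have "F (z + a * of_int i') = x"
        using F_shift[of z i'] F_eq[of z] unfolding y(1) z(2) i'_def by (simp add: algebra_simps)
      then show ?thesis using z(1) by blast
    qed
  qed
qed

end

section \<open>Opening gaps in a rotation\<close>

lemma int_strict_mono_bracket:
  fixes f :: "int \<Rightarrow> int"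
  assumes "\<And>i. f i < f (i + 1)"
  shows "\<exists>!i. f (i - 1) < j \<and> j \<le> f i"
proof -
  have grow: "f i + int n \<le> f (i + int n)" for i n
  proof (induction n)
    case (Suc n)
    then show ?case using assms[of "i + int n"] by (simp add: algebra_simps)
  qed simp
  have mono: "f i \<le> f i'" if "i \<le> i'" for i i'
    using grow[of i "nat (i' - i)"] that by simp
  define i0 where "i0 = - int (nat \<bar>f 0 - j\<bar>) - 1"
  have lo: "f i0 < j"
    using grow[of i0 "nat \<bar>f 0 - j\<bar> + 1"] by (simp add: i0_def)
  have "\<exists>n. j \<le> f (i0 + int n)"
    using grow[of i0 "nat (j - f i0)"] lo by (intro exI[of _ "nat (j - f i0)"]) simp
  define n where "n = (LEAST n. j \<le> f (i0 + int n))"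
  have n: "j \<le> f (i0 + int n)" unfolding n_def by (rule LeastI_ex) fact
  have "0 < n" using n lo by (cases n) auto
  have "\<not> j \<le> f (i0 + int (n - 1))"
    using not_less_Least[of "n - 1" "\<lambda>n. j \<le> f (i0 + int n)"] \<open>0 < n\<close> by (simp add: n_def)
  then have "f (i0 + int n - 1) < j" using \<open>0 < n\<close> by (simp add: of_nat_diff algebra_simps)
  with n have "\<exists>i. f (i - 1) < j \<and> j \<le> f i" by blast
  moreover have "i = i'" if "f (i - 1) < j \<and> j \<le> f i" "f (i' - 1) < j \<and> j \<le> f i'" for i i'
    using that mono[of i "i' - 1"] mono[of i' "i - 1"] by linarith
  ultimately show ?thesis by blast
qed

context gap_map begin

text \<open>Conversely, opening gaps of length \<open>\<delta>\<close> at the points \<open>\<theta>, \<dots>, D\<theta>\<close> of the circle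
  \<open>\<real>/L\<int>\<close> turns the rotation by \<open>\<theta>\<close> into an orbit of \<open>F\<close>.\<close>

lemma ex_orbit:
  fixes d1 d2 :: nat and k :: int
  defines "D \<equiv> d1 + d2 + 1"
  defines "L \<equiv> a - of_nat D * \<delta>" and "\<theta> \<equiv> c1 - of_int k * \<delta>" and "l \<equiv> c0 - (of_nat d1 + 1) * \<delta>"
  assumes cycle: "of_nat D * c1 + (of_nat d1 + 1) * \<delta> = c0 + a * of_int k"
    and d1: "(of_nat d1 + 1) * \<delta> < c0" and d2: "of_nat d2 * \<delta> < a - c0"
    and card: "card {n :: int. 1 \<le> n \<and> n \<le> int D \<and> of_int n * \<theta> \<in> plus_lattice {0..<l} L} = d1"
  shows "\<exists>t (\<kappa> :: int \<Rightarrow> int). \<kappa> 0 = 0 \<and> (\<forall>i.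
    \<kappa> (i + 1) = \<kappa> i + N + 1 \<and> md (t + (a + \<delta>) * of_int (\<kappa> i)) < c0 - \<delta> \<or>
    \<kappa> (i + 1) = \<kappa> i + N \<and> c0 \<le> md (t + (a + \<delta>) * of_int (\<kappa> i)))"
proof -
  have D_real: "real D = real d1 + real d2 + 1" by (simp add: D_def)
  have l: "0 < l" "l < L" using d1 d2 by (simp_all add: l_def L_def D_real algebra_simps)
  then have L: "0 < L" by simp
  \<comment> \<open>The last gap point falls at residue \<open>l\<close>, so that its gap will open
    just before \<open>c0\<close>.\<close>
  have D\<theta>: "of_nat D * \<theta> = l + L * of_int k"
    using cycle by (simp add: \<theta>_def l_def L_def algebra_simps)
  have res_D: "residue L (of_nat D * \<theta>) = l" "\<lfloor>of_nat D * \<theta> / L\<rfloor> = k"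
    using residue_unique[OF L D\<theta>] l by simp_all
  have "{n :: int. 1 \<le> n \<and> n \<le> int D \<and> of_int n * \<theta> \<in> plus_lattice {0..<l} L}
      = int ` {n \<in> {1..D}. residue L (of_nat n * \<theta>) < l}" (is "?A = ?B")
  proof (intro equalityI subsetI)
    fix n assume "n \<in> ?A"
    then show "n \<in> ?B" using mem_plus_lattice_iff[OF L] l by (intro image_eqI[of _ _ "nat n"]) auto
  next
    fix n assume "n \<in> ?B"
    then show "n \<in> ?A" using mem_plus_lattice_iff[OF L] l by auto
  qed
  then have cardE: "card {n \<in> {1..D}. residue L (of_nat n * \<theta>) < l} = d1"
    using card by (simp add: card_image)
  \<comment> \<open>The floor sum of \<open>cnt\<close>, now at every real, with the gap points
    prescribed; \<open>w0\<close> below normalises it.\<close>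
  define w :: "real \<Rightarrow> int" where "w y = (\<Sum>i<D. \<lfloor>(y - of_nat (Suc i) * \<theta>) / L\<rfloor>)" for y
  define C where "C y = card {n \<in> {1..D}. residue L (of_nat n * \<theta>) \<le> residue L y}" for y
  define w0 :: int where "w0 = (\<Sum>i<D. \<lfloor>of_nat (Suc i) * \<theta> / L\<rfloor> + 1)"
  have w_eq: "w y + w0 = int D * \<lfloor>y / L\<rfloor> + int (C y)" for y
  proof -
    have "w y + w0 = (\<Sum>i<D. \<lfloor>y / L\<rfloor> + (if residue L (of_nat (Suc i) * \<theta>) \<le> residue L y then 1 else 0))"
      unfolding w_def w0_def sum.distrib[symmetric]
      by (rule sum.cong) (auto simp: floor_diff_divide[OF L])
    also have "\<dots> = int D * \<lfloor>y / L\<rfloor> + (\<Sum>n\<in>{1..D}. if residue L (of_nat n * \<theta>) \<le> residue L y then 1 else 0)"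
      by (simp add: sum.distrib sum.atLeast1_atMost_eq)
    also have "(\<Sum>n\<in>{1..D}. if residue L (of_nat n * \<theta>) \<le> residue L y then 1 else 0) = int (C y)"
      by (simp add: C_def sum.If_cases Int_def)
    finally show ?thesis .
  qed
  have w_step: "w (y + \<theta>) = w y + k + (if residue L y < l then 1 else 0)" for y
  proof -
    let ?f = "\<lambda>i. \<lfloor>(y - of_nat i * \<theta>) / L\<rfloor>"
    have "w (y + \<theta>) - w y = (\<Sum>i<D. ?f i - ?f (Suc i))"
      unfolding w_def sum_subtractf[symmetric] by (rule sum.cong) (auto simp: algebra_simps)
    also have "\<dots> = ?f 0 - ?f D" by (rule sum_lessThan_telescope')
    also have "?f D = \<lfloor>y / L\<rfloor> - k - (if residue L y < l then 1 else 0)"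
      using floor_diff_divide[OF L, of y "of_nat D * \<theta>"] res_D by simp
    finally show ?thesis by simp
  qed
  \<comment> \<open>Opening the gaps stretches a period from \<open>L\<close> to
    \<open>L + D * \<delta> = a\<close>.\<close>
  define X where "X y = y + \<delta> * of_int (w y + w0)" for y
  have X_eq: "X y = (residue L y + \<delta> * of_nat (C y)) + a * of_int \<lfloor>y / L\<rfloor>" for y
    unfolding X_def w_eq using residue_decomp[of y L] by (simp add: L_def algebra_simps)
  have C_le: "\<delta> * of_nat (C y) \<le> \<delta> * of_nat D" for y
  proof -
    have "C y \<le> card {1..D}" unfolding C_def by (rule card_mono) auto
    then show ?thesis using \<delta>_pos by simp
  qed
  have res_X: "md (X y) = residue L y + \<delta> * of_nat (C y)" for y
  proof (rule md_unique(1)[OF X_eq])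
    show "0 \<le> residue L y + \<delta> * of_nat (C y)" using residue_bounds[OF L] \<delta>_pos by simp
    have "L + \<delta> * of_nat D = a" by (simp add: L_def)
    then show "residue L y + \<delta> * of_nat (C y) < a"
      using residue_bounds(2)[OF L, of y] C_le[of y] by linarith
  qed
  \<comment> \<open>A position before \<open>l\<close> has at most \<open>d1\<close> gap points up
    to it. A position from \<open>l\<close> on also has the \<open>D\<close>-th, hence at least
    \<open>d1 + 1\<close>. So the images avoid \<open>[c0 - \<delta>, c0)\<close>.\<close>
  have X_low: "md (X y) < c0 - \<delta>" if "residue L y < l" for y
  proof -
    have "C y \<le> d1" unfolding C_def cardE[symmetric] by (rule card_mono) (use that in auto)
    then have "\<delta> * of_nat (C y) \<le> \<delta> * of_nat d1" using \<delta>_pos by simp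
    then show ?thesis using that by (simp add: res_X l_def algebra_simps)
  qed
  have X_high: "c0 \<le> md (X y)" if "\<not> residue L y < l" for y
  proof -
    have "card (insert D {n \<in> {1..D}. residue L (of_nat n * \<theta>) < l}) \<le> C y"
      unfolding C_def by (rule card_mono) (use that res_D D_def in auto)
    then have "d1 + 1 \<le> C y" using res_D cardE by simp
    then have "real d1 + 1 \<le> real (C y)" by linarith
    then have "\<delta> * (real d1 + 1) \<le> \<delta> * of_nat (C y)" using \<delta>_pos by simp
    then show ?thesis using that by (simp add: res_X l_def algebra_simps)
  qed
  \<comment> \<open>The terms after \<open>N * i\<close> count the long steps, with sign for
    negative \<open>i\<close>.\<close>
  define \<kappa> where "\<kappa> i = N * i + w (of_int i * \<theta>) - w 0 - k * i" for i
  have \<kappa>_step: "\<kappa> (i + 1) = \<kappa> i + N + (if residue L (of_int i * \<theta>) < l then 1 else 0)" for i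
    using w_step[of "of_int i * \<theta>"] by (simp add: \<kappa>_def algebra_simps)
  have "X 0 + (a + \<delta>) * of_int (\<kappa> i) = X (of_int i * \<theta>) + a * of_int (\<kappa> i - i * p)" for i
    by (simp add: X_def \<kappa>_def \<theta>_def c1_eq algebra_simps)
  then have \<kappa>_md: "md (X 0 + (a + \<delta>) * of_int (\<kappa> i)) = md (X (of_int i * \<theta>))" for i
    by (simp only: md_shift)
  have "\<kappa> 0 = 0" by (simp add: \<kappa>_def)
  moreover have "\<kappa> (i + 1) = \<kappa> i + N + 1 \<and> md (X 0 + (a + \<delta>) * of_int (\<kappa> i)) < c0 - \<delta> \<or>
    \<kappa> (i + 1) = \<kappa> i + N \<and> c0 \<le> md (X 0 + (a + \<delta>) * of_int (\<kappa> i))" for i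
    unfolding \<kappa>_md using \<kappa>_step[of i] X_low X_high by auto
  ultimately show ?thesis by blast
qed

text \<open>Each step leads into the stretch by which window \<open>f i + 1\<close> extends beyond
  window \<open>f i\<close>. Hence \<open>\<tau> i\<close> lies in window \<open>j\<close> exactly
  for \<open>f (i - 1) < j \<le> f i\<close>, and these integer intervals partition the
  windows.\<close>

lemma orbit_windows:
  fixes \<kappa> :: "int \<Rightarrow> int"
  defines "b \<equiv> a + \<delta>"
  assumes orbit: "\<And>i. \<kappa> (i + 1) = \<kappa> i + N + 1 \<and> md (t + b * of_int (\<kappa> i)) < c0 - \<delta> \<or>
    \<kappa> (i + 1) = \<kappa> i + N \<and> c0 \<le> md (t + b * of_int (\<kappa> i))"
  shows "\<exists>!k. t - a * of_int j + b * of_int k \<in> {0..<of_int N * b + c0} \<and> k \<in> range \<kappa>"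
proof -
  define c where "c = of_int N * b + c0"
  define \<tau> where "\<tau> i = t + b * of_int (\<kappa> i)" for i
  define f where "f i = \<lfloor>\<tau> i / a\<rfloor>" for i
  have step: "\<lfloor>(\<tau> (i + 1) - c) / a\<rfloor> = f i" for i
  proof -
    define u where "u = md (\<tau> i)"
    have u: "\<tau> i = u + a * of_int (f i)" "0 \<le> u" "u < a"
      using md_decomp[of "\<tau> i"] md_bounds[of "\<tau> i"] by (simp_all add: u_def f_def)
    from orbit[of i] show ?thesis
    proof
      assume H: "\<kappa> (i + 1) = \<kappa> i + N + 1 \<and> md (t + b * of_int (\<kappa> i)) < c0 - \<delta>"
      then have "u < c0 - \<delta>" by (simp add: u_def \<tau>_def)
      moreover have "\<tau> (i + 1) - c = (u + b - c0) + a * of_int (f i)"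
        using H u(1) by (simp add: \<tau>_def c_def algebra_simps)
      ultimately show ?thesis
        using md_unique(2) u c0_less \<delta>_pos by (simp add: b_def)
    next
      assume H: "\<kappa> (i + 1) = \<kappa> i + N \<and> c0 \<le> md (t + b * of_int (\<kappa> i))"
      then have "c0 \<le> u" by (simp add: u_def \<tau>_def)
      moreover have "\<tau> (i + 1) - c = (u - c0) + a * of_int (f i)"
        using H u(1) by (simp add: \<tau>_def c_def algebra_simps)
      ultimately show ?thesis
        using md_unique(2) u \<delta>_less \<delta>_pos by simp
    qed
  qed
  have "1 * b \<le> of_int N * b" by (rule mult_right_mono) (use N_pos a_pos \<delta>_pos in \<open>auto simp: b_def\<close>)
  then have c_gt: "a < c" using \<delta>_pos \<delta>_less by (simp add: c_def b_def)
  have f_less: "f i < f (i + 1)" for i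
  proof -
    have "(\<tau> (i + 1) - c) / a + 1 \<le> \<tau> (i + 1) / a"
      using c_gt a_pos by (simp add: diff_divide_distrib)
    then show ?thesis using step[of i] unfolding f_def[of "i + 1"] by linarith
  qed
  have win: "t - a * of_int j + b * of_int (\<kappa> i) \<in> {0..<c} \<longleftrightarrow> f (i - 1) < j \<and> j \<le> f i" for i
  proof -
    have "j \<le> f i \<longleftrightarrow> a * of_int j \<le> \<tau> i"
      using a_pos by (simp add: f_def le_floor_iff pos_le_divide_eq mult.commute)
    moreover have "f (i - 1) < j \<longleftrightarrow> \<tau> i < a * of_int j + c"
      using step[of "i - 1"] a_pos by (simp add: floor_less_iff pos_divide_less_eq algebra_simps flip: step[of "i - 1"])
    ultimately show ?thesis by (auto simp: \<tau>_def)
  qed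
  obtain i where i: "f (i - 1) < j \<and> j \<le> f i" "\<And>i'. f (i' - 1) < j \<and> j \<le> f i' \<Longrightarrow> i' = i"
    using int_strict_mono_bracket[of f j, OF f_less] by blast
  show ?thesis unfolding c_def[symmetric]
  proof (rule ex1I[of _ "\<kappa> i"])
    show "t - a * of_int j + b * of_int (\<kappa> i) \<in> {0..<c} \<and> \<kappa> i \<in> range \<kappa>"
      using win i(1) by blast
    show "k = \<kappa> i" if "t - a * of_int j + b * of_int k \<in> {0..<c} \<and> k \<in> range \<kappa>" for k
      using that win i(2) by blast
  qed
qed

end

section \<open>The criterion\<close>

theorem theorem6p1:
  fixes a b c :: real
  defines "N \<equiv> \<lfloor>c / b\<rfloor>"
  defines "c0 \<equiv> c - of_int \<lfloor>c / b\<rfloor> * b"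
  defines "c1 \<equiv> c - (c - of_int \<lfloor>c / b\<rfloor> * b)
                 - of_int \<lfloor>(c - (c - of_int \<lfloor>c / b\<rfloor> * b)) / a\<rfloor> * a"
  assumes "0 < a" "a < b" "b < c"
    and "N \<ge> 2"
    and "b - a < c0" "c0 < a"
    and "0 < c1" "c1 < 2 * a - b"
    and "a / b \<notin> \<rat>"
  shows "S_set a b c \<noteq> {} \<longleftrightarrow>
    (\<exists>d1 d2 :: nat.
       c - (real d1 + 1) * (of_int N + 1) * (b - a) - (real d2 + 1) * of_int N * (b - a)
         \<in> lattice a
     \<and> of_int N * b + (real d1 + 1) * (b - a) < c
     \<and> c < of_int N * b + b - (real d2 + 1) * (b - a)
     \<and> (let m = ((real d1 + real d2 + 1) * c1 - c0 + (real d1 + 1) * (b - a)) / a;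
            E = {n::int. 1 \<le> n \<and> n \<le> int d1 + int d2 + 1 \<and>
                   of_int n * (c1 - m * (b - a))
                     \<in> plus_lattice {0..<c0 - (real d1 + 1) * (b - a)}
                                    (a - (real d1 + real d2 + 1) * (b - a))}
        in card E = d1))"
proof -
  define \<delta> where "\<delta> = b - a"
  have b_pos: "0 < b" using \<open>0 < a\<close> \<open>a < b\<close> by simp
  define K where "K = \<lfloor>(c - c0) / a\<rfloor>"
  define p where "p = N - K"
  have c_eq: "c = of_int N * b + c0" by (simp add: N_def c0_def)
  have c1_eq: "c1 = of_int N * \<delta> + of_int p * a"
    by (simp add: c1_def c0_def N_def K_def p_def \<delta>_def algebra_simps)
  interpret gap_map a \<delta> c0 c1 N p
  proof
    fix i j :: int assume ij: "of_int i * \<delta> = of_int j * a"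
    show "i = 0"
    proof (rule ccontr)
      assume "i \<noteq> 0"
      have eq: "of_int i * b = of_int (i + j) * a" using ij by (simp add: \<delta>_def algebra_simps)
      moreover have "of_int i * b \<noteq> 0" using \<open>i \<noteq> 0\<close> b_pos by simp
      ultimately have "real_of_int (i + j) \<noteq> 0" by (metis mult_zero_left)
      then have "a / b = of_int i / of_int (i + j)"
        using eq b_pos by (simp add: divide_eq_eq eq_divide_eq mult.commute)
      then show False using \<open>a / b \<notin> \<rat>\<close> by simp
    qed
  qed (use assms c1_eq in \<open>auto simp: \<delta>_def\<close>)
  \<comment> \<open>Condition (1) is the closing equation \<open>cycle_eq\<close> for an integer
    \<open>k\<close>, and \<open>m_eq\<close> below identifies this \<open>k\<close> with
    \<open>m\<close>.\<close>
  have cycle_iff: "c - (real d1 + 1) * (of_int N + 1) * (b - a) - (real d2 + 1) * of_int N * (b - a) = a * of_int j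
      \<longleftrightarrow> real (d1 + d2 + 1) * c1 + (real d1 + 1) * \<delta> = c0 + a * of_int (N - j + int (d1 + d2 + 1) * p)" for d1 d2 j
    unfolding c1_eq c_eq \<delta>_def by (auto simp: algebra_simps)
  have cond2: "of_int N * b + (real d1 + 1) * (b - a) < c \<longleftrightarrow> (real d1 + 1) * \<delta> < c0"
    "c < of_int N * b + b - (real d2 + 1) * (b - a) \<longleftrightarrow> real d2 * \<delta> < a - c0" for d1 d2 :: nat
    using c_eq by (auto simp: \<delta>_def algebra_simps)
  have m_eq: "((real d1 + real d2 + 1) * c1 - c0 + (real d1 + 1) * (b - a)) / a = of_int k"
    if "real (d1 + d2 + 1) * c1 + (real d1 + 1) * \<delta> = c0 + a * of_int k" for d1 d2 k
    using that a_pos by (simp add: \<delta>_def field_simps)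
  have E_eq: "{n :: int. 1 \<le> n \<and> n \<le> int d1 + int d2 + 1 \<and> of_int n * (c1 - of_int k * (b - a))
        \<in> plus_lattice {0..<c0 - (real d1 + 1) * (b - a)} (a - (real d1 + real d2 + 1) * (b - a))}
      = {n :: int. 1 \<le> n \<and> n \<le> int (d1 + d2 + 1) \<and> of_int n * (c1 - of_int k * \<delta>)
        \<in> plus_lattice {0..<c0 - (of_nat d1 + 1) * \<delta>} (a - of_nat (d1 + d2 + 1) * \<delta>)}" for d1 d2 k
    by (simp add: \<delta>_def add_ac)
  show ?thesis
  proof
    assume "S_set a b c \<noteq> {}"
    then obtain t x where x: "x \<in> B0" "\<And>j. Mmult a b c t x j = 1" unfolding S_set_def by blast
    have win: "\<exists>!k. t - a * of_int j + b * of_int k \<in> {0..<c} \<and> x k = 1" for j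
      using Mmult_eq_1_iff[of b x a c t j] x b_pos by (auto simp: B0_def)
    \<comment> \<open>Each row equation becomes a unique point of \<open>T\<close> in the
      corresponding window.\<close>
    define T where "T = {t + b * of_int k | k. x k = 1}"
    interpret window_tiling a b c0 N T
    proof
      show "T \<noteq> {}" using x(1) by (auto simp: T_def B0_def)
      show "\<exists>k :: int. y = x + b * of_int k" if xy: "x \<in> T" "y \<in> T" for x y
      proof -
        obtain i j where "x = t + b * of_int i" "y = t + b * of_int j" using xy by (auto simp: T_def)
        then have "y = x + b * of_int (j - i)" by (simp add: algebra_simps)
        then show ?thesis by blast
      qed
      show "\<exists>!y. y \<in> T \<and> a * of_int j \<le> y \<and> y < a * of_int j + (of_int N * b + c0)" for j
      proof -
        have mem: "t - a * of_int j + b * of_int k \<in> {0..<c} \<longleftrightarrow>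
          a * of_int j \<le> t + b * of_int k \<and> t + b * of_int k < a * of_int j + (of_int N * b + c0)" for k
          unfolding c_eq[symmetric] by auto
        from win[of j] show ?thesis unfolding mem T_def by blast
      qed
    qed (use assms in auto)
    interpret gap_orbit a \<delta> c0 c1 N p "{x + a * of_int j | x j. x \<in> T}"
      using gap_orbitI[of c1 p] gap_map_axioms by (simp add: \<delta>_def)
    obtain D k where "gap_cycle a \<delta> c0 c1 N p orb D k" using ex_cycle by blast
    then interpret cyc: gap_cycle a \<delta> c0 c1 N p orb D k .
    let ?d1 = cyc.d1 and ?d2 = cyc.d2
    define j where "j = N - k + int (?d1 + ?d2 + 1) * p"
    have cyc: "real (?d1 + ?d2 + 1) * c1 + (real ?d1 + 1) * \<delta> = c0 + a * of_int k"
      using cyc.cycle_eq by (simp only: cyc.D_eq[symmetric])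
    then have "c - (real ?d1 + 1) * (of_int N + 1) * (b - a) - (real ?d2 + 1) * of_int N * (b - a) = a * of_int j"
      unfolding cycle_iff by (simp add: j_def)
    moreover have "card {n :: int. 1 \<le> n \<and> n \<le> int (?d1 + ?d2 + 1) \<and> of_int n * (c1 - of_int k * \<delta>)
        \<in> plus_lattice {0..<c0 - (of_nat ?d1 + 1) * \<delta>} (a - of_nat (?d1 + ?d2 + 1) * \<delta>)} = ?d1"
      using cyc.card_rotation unfolding cyc.\<theta>_def cyc.l_def cyc.L_def by (simp only: cyc.D_eq[symmetric])
    ultimately show "\<exists>d1 d2 :: nat.
       c - (real d1 + 1) * (of_int N + 1) * (b - a) - (real d2 + 1) * of_int N * (b - a)
         \<in> lattice a
     \<and> of_int N * b + (real d1 + 1) * (b - a) < c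
     \<and> c < of_int N * b + b - (real d2 + 1) * (b - a)
     \<and> (let m = ((real d1 + real d2 + 1) * c1 - c0 + (real d1 + 1) * (b - a)) / a;
            E = {n::int. 1 \<le> n \<and> n \<le> int d1 + int d2 + 1 \<and>
                   of_int n * (c1 - m * (b - a))
                     \<in> plus_lattice {0..<c0 - (real d1 + 1) * (b - a)}
                                    (a - (real d1 + real d2 + 1) * (b - a))}
        in card E = d1)"
      unfolding cond2 Let_def lattice_def using cyc.d1_bound cyc.d2_bound
      by (intro exI[of _ ?d1] exI[of _ ?d2]) (unfold m_eq[OF cyc] E_eq, blast)
  next
    assume "\<exists>d1 d2 :: nat.
       c - (real d1 + 1) * (of_int N + 1) * (b - a) - (real d2 + 1) * of_int N * (b - a)
         \<in> lattice a
     \<and> of_int N * b + (real d1 + 1) * (b - a) < c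
     \<and> c < of_int N * b + b - (real d2 + 1) * (b - a)
     \<and> (let m = ((real d1 + real d2 + 1) * c1 - c0 + (real d1 + 1) * (b - a)) / a;
            E = {n::int. 1 \<le> n \<and> n \<le> int d1 + int d2 + 1 \<and>
                   of_int n * (c1 - m * (b - a))
                     \<in> plus_lattice {0..<c0 - (real d1 + 1) * (b - a)}
                                    (a - (real d1 + real d2 + 1) * (b - a))}
        in card E = d1)"
    then obtain d1 d2 :: nat where
      cond1: "c - (real d1 + 1) * (of_int N + 1) * (b - a) - (real d2 + 1) * of_int N * (b - a) \<in> lattice a"
      and bounds: "(real d1 + 1) * \<delta> < c0" "real d2 * \<delta> < a - c0"
      and card: "card {n::int. 1 \<le> n \<and> n \<le> int d1 + int d2 + 1 \<and>
           of_int n * (c1 - ((real d1 + real d2 + 1) * c1 - c0 + (real d1 + 1) * (b - a)) / a * (b - a))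
             \<in> plus_lattice {0..<c0 - (real d1 + 1) * (b - a)} (a - (real d1 + real d2 + 1) * (b - a))} = d1"
      unfolding cond2 Let_def by blast
    obtain j where "c - (real d1 + 1) * (of_int N + 1) * (b - a) - (real d2 + 1) * of_int N * (b - a) = a * of_int j"
      using cond1 unfolding lattice_def by blast
    then obtain k where k: "real (d1 + d2 + 1) * c1 + (real d1 + 1) * \<delta> = c0 + a * of_int k"
      unfolding cycle_iff by blast
    have "a + \<delta> = b" by (simp add: \<delta>_def)
    then obtain t and \<kappa> :: "int \<Rightarrow> int" where \<kappa>: "\<kappa> 0 = 0" "\<And>i.
        \<kappa> (i + 1) = \<kappa> i + N + 1 \<and> md (t + b * of_int (\<kappa> i)) < c0 - \<delta> \<or>
        \<kappa> (i + 1) = \<kappa> i + N \<and> c0 \<le> md (t + b * of_int (\<kappa> i))"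
      using ex_orbit[OF k bounds card[unfolded m_eq[OF k] E_eq]] by auto
    define x :: "int \<Rightarrow> real" where "x i = (if i \<in> range \<kappa> then 1 else 0)" for i
    have "0 \<in> range \<kappa>" by (rule range_eqI[of _ _ 0]) (simp add: \<kappa>(1))
    then have "x \<in> B0" by (simp add: B0_def x_def)
    moreover have "Mmult a b c t x j = 1" for j
    proof -
      have "\<exists>!i. t - a * of_int j + b * of_int i \<in> {0..<c} \<and> i \<in> range \<kappa>"
        using orbit_windows[of \<kappa> t j] \<kappa>(2) unfolding \<open>a + \<delta> = b\<close> c_eq by blast
      then show ?thesis
        by (subst Mmult_eq_1_iff) (auto simp: x_def b_pos)
    qed
    ultimately have "t \<in> S_set a b c" unfolding S_set_def by blast
    then show "S_set a b c \<noteq> {}" by blast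
  qed
qed

end
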